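(* For every wavenumber $k>0$ there exists a one-parameter family of traveling waves $u(x,t)=\eta(a;k)\big(k(x-c(a;k)t)\big)$, for $a\in\mathbb{R}$ with $|a|$ sufficiently small, where $\eta=\eta(a;k)$ and $c=c(a;k)>0$ solve $$(3c^{2}-2\eta)k^{2}\eta''-k^{2}(\eta')^{2}+\eta=0 .$$ Here $\eta(a;k)(\cdot)$ is $2\pi$-periodic, even and smooth in its argument, $c(a;k)$ is even in $a$, and $\eta(a;k)(\cdot)$ and $c(a;k)$ depend analytically on $a$ and $k$. Moreover, as $a\to0$, $$\eta(a;k)(z)=a\cos z+a^{2}\left(A_0+A_2\cos 2z\right)+a^{3}A_3\cos 3z+O(a^4),$$ $$c(a;k)=c_0+a^2c_2+O(a^4),$$ where $$A_0=-\frac{k^2}{2},\quad A_2=-A_0,\quad A_3=\frac{7k^4}{16},\quad c_0=\frac{1}{\sqrt3\,k},\quad c_2=\frac{k^3}{4\sqrt3}.$$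
   Context: The differential equation is the one satisfied by the profile $\eta(z)$, $z=k(x-ct)$, of a $2\pi/k$-periodic traveling wave $u(x,t)=\eta(k(x-ct))$ of the local shallow water model $(c^{2}-2u)u_{xx}-(u_x)^{2}+u-2c\,u_{tx}=0$, in which the parameter $c>0$ equals the wave speed. The profile $\eta(a;k)$ is regarded as an element of $H^2_{\mathrm{even}}(\mathbb{T})$, the space of even $2\pi$-periodic $H^2$ functions ($\mathbb{T}=\mathbb{R}/2\pi\mathbb{Z}$); analytic dependence and the $O(a^4)$ remainder for $\eta$ are understood in this space. *)

theory Defs
  imports "HOL-Analysis.Analysis" "HOL-Library.Landau_Symbols"
begin

definition smooth :: "(real \<Rightarrow> real) \<Rightarrow> bool" where
  "smooth f \<longleftrightarrow> (\<forall>n z. (deriv ^^ n) f differentiable (at z))"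

definition fourier_coeff :: "(real \<Rightarrow> real) \<Rightarrow> int \<Rightarrow> complex" where
  "fourier_coeff f n =
     integral {-pi..pi} (\<lambda>z. complex_of_real (f z) * cis (- (of_int n * z))) / (2 * pi)"

text \<open>Even, \<open>2\<pi>\<close>-periodic functions of Sobolev class \<open>H\<^sup>2\<close>. Since \<open>H\<^sup>2\<close> embeds into the continuous
  functions, every class modulo null sets is identified with its unique continuous representative.\<close>

definition H2_even :: "(real \<Rightarrow> real) set" where
  "H2_even = {f. continuous_on UNIV f \<and> (\<forall>z. f (z + 2 * pi) = f z) \<and> (\<forall>z. f (- z) = f z) \<and>
     (\<lambda>n::int. (1 + (of_int n)\<^sup>2)\<^sup>2 * (cmod (fourier_coeff f n))\<^sup>2) summable_on UNIV}"

text \<open>Meaningful only on \<^const>\<open>H2_even\<close>: outside it the sum may be the junk value 0.\<close>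

definition H2_norm :: "(real \<Rightarrow> real) \<Rightarrow> real" where
  "H2_norm f = sqrt (\<Sum>\<^sub>\<infinity>n::int. (1 + (of_int n)\<^sup>2)\<^sup>2 * (cmod (fourier_coeff f n))\<^sup>2)"

text \<open>Joint real analyticity in two real variables, for maps with values in \<open>\<real>\<close> and in
  \<^const>\<open>H2_even\<close>: near each point of \<open>U\<close> the map is the sum of a double power series, in the second case
  with coefficients in \<^const>\<open>H2_even\<close> and unconditional convergence in the \<open>H\<^sup>2\<close> norm. As the
  expansion holds on a full square, absolute convergence on smaller squares is automatic. Both
  notions are meant for open \<open>U\<close>.\<close>

definition real_analytic2_on :: "(real \<Rightarrow> real \<Rightarrow> real) \<Rightarrow> (real \<times> real) set \<Rightarrow> bool" where
  "real_analytic2_on f U \<longleftrightarrow>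
     (\<forall>(a0, k0)\<in>U. \<exists>r>0. \<exists>e :: nat \<Rightarrow> nat \<Rightarrow> real.
        \<forall>a k. \<bar>a - a0\<bar> < r \<and> \<bar>k - k0\<bar> < r \<longrightarrow>
          (a, k) \<in> U \<and>
          ((\<lambda>(m, n). (a - a0) ^ m * (k - k0) ^ n * e m n) has_sum f a k) UNIV)"

definition H2_analytic2_on :: "(real \<Rightarrow> real \<Rightarrow> real \<Rightarrow> real) \<Rightarrow> (real \<times> real) set \<Rightarrow> bool" where
  "H2_analytic2_on f U \<longleftrightarrow>
     (\<forall>(a0, k0)\<in>U. \<exists>r>0. \<exists>e :: nat \<Rightarrow> nat \<Rightarrow> real \<Rightarrow> real.
        (\<forall>m n. e m n \<in> H2_even) \<and>
        (\<forall>a k. \<bar>a - a0\<bar> < r \<and> \<bar>k - k0\<bar> < r \<longrightarrow>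
          (a, k) \<in> U \<and> f a k \<in> H2_even \<and>
          ((\<lambda>F. H2_norm (\<lambda>z. f a k z - (\<Sum>(m, n)\<in>F. (a - a0) ^ m * (k - k0) ^ n * e m n z)))
             \<longlongrightarrow> 0) (finite_subsets_at_top UNIV)))"

text \<open>Classical solutions \<open>u(x,t)\<close> of
  \<open>(c\<^sup>2 - 2u) u\<^sub>x\<^sub>x - (u\<^sub>x)\<^sup>2 + u - 2c u\<^sub>t\<^sub>x = 0\<close>.\<close>

definition shallow_water_solution :: "real \<Rightarrow> (real \<Rightarrow> real \<Rightarrow> real) \<Rightarrow> bool" where
  "shallow_water_solution c u \<longleftrightarrow>
     (\<exists>ux uxx ut utx. \<forall>x t.
        ((\<lambda>y. u y t) has_real_derivative ux x t) (at x) \<and>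
        ((\<lambda>y. ux y t) has_real_derivative uxx x t) (at x) \<and>
        ((\<lambda>s. u x s) has_real_derivative ut x t) (at t) \<and>
        ((\<lambda>y. ut y t) has_real_derivative utx x t) (at x) \<and>
        (c\<^sup>2 - 2 * u x t) * uxx x t - (ux x t)\<^sup>2 + u x t - 2 * c * utx x t = 0)"

end

theory Submission
  imports Defs "HOL-Complex_Analysis.Cauchy_Integral_Formula"
begin

text \<open>
  The wave is built as a power series in its amplitude (a Stokes expansion): a recursion
  determines the coefficients, and a majorant shows that the series converges.

  Scaling removes the wavenumber: with \<open>b = k\<^sup>2 a\<close>, \<open>\<eta> = H(b) / k\<^sup>2\<close> and \<open>\<mu> = 3 c\<^sup>2 k\<^sup>2\<close> the
  equation becomes \<open>(\<mu> - 2 H) H'' - H'\<^sup>2 + H = 0\<close>. Inserting \<open>H = \<Sum> b\<^sup>m P\<^sub>m\<close> and \<open>\<mu> = \<Sum> b\<^sup>j \<mu>\<^sub>j\<close>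
  with \<open>P\<^sub>1 = cos\<close>, \<open>\<mu>\<^sub>0 = 1\<close>, and \<open>P\<^sub>m\<close> an even trigonometric polynomial of degree \<open>m\<close>, the
  coefficient of \<open>b\<^sup>m\<close> at frequency \<open>n\<close> is a linear equation for the \<open>n\<close>-th coefficient of \<open>P\<^sub>m\<close> with
  factor \<open>1 - n\<^sup>2\<close>. It can be solved unless \<open>n = \<plusminus>1\<close>; at the resonant frequencies the coefficient of
  \<open>P\<^sub>m\<close> is set to zero for \<open>m \<ge> 2\<close>, and the equation determines \<open>\<mu>\<^bsub>m-1\<^esub>\<close> instead. This is the recursion
  \<open>stokes\<close>/\<open>speed_coeff\<close>, and \<open>stokes_coeff_identity\<close> records that it solves every order. Parity of the
  frequencies makes \<open>\<mu>\<close> even in \<open>b\<close>.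

  Convergence: the factor \<open>1 - n\<^sup>2\<close> recovers exactly the two derivatives that the nonlinear terms lose, so
  the weighted norms \<open>stokes_norm m = \<Sum>\<^sub>n (1 + n\<^sup>2) \<bar>stokes m n\<bar>\<close> satisfy a closed convolution inequality.
  The sequence \<open>K\<^sup>m / m\<^sup>2\<close> reproduces itself under convolution up to a constant, which gives geometric
  growth (\<open>stokes_norm_majorant\<close>). Since \<open>P\<^sub>m\<close> has degree \<open>m\<close>, all derivatives of the series converge as
  well, so the profile is smooth and Cauchy products turn the order-by-order identities into the
  differential equation (\<open>stokes_wave_equation\<close>).

  Analyticity: undoing the scaling gives \<open>\<eta>(a;k) = \<Sum> a\<^sup>m k\<^bsup>2m-2\<^esup> P\<^sub>m\<close>, whose terms are polynomials in
  \<open>(a, k)\<close> with fixed profiles. Re-expanding them at a point by the binomial theorem and rearranging the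
  absolutely convergent sum yields the double power series. The norm that controls this is the weighted
  absolute sum of Fourier coefficients, which dominates the \<open>H\<^sup>2\<close> norm (\<open>H2_bounded\<close>). The speed is
  \<open>c = sqrt (\<mu> / 3) / k\<close>; a holomorphic square root gives its power series in \<open>b\<close>. The terms of order
  at most three are computed from the recursion, and the tails of the series are \<open>O(a\<^sup>4)\<close>.
\<close>

section \<open>Absolutely convergent even Fourier series in \<open>H\<^sup>2\<close>\<close>

text \<open>\<open>f\<close> is an even Fourier series with \<open>\<Sum> (1 + n\<^sup>2) \<bar>g n\<bar> \<le> B\<close>. An absolute sum is easier to add up
  over infinite families than the square sum in \<^const>\<open>H2_norm\<close>, and it dominates it because a sum of
  squares is at most the square of the sum. Coefficients are indexed by \<open>int\<close>, and evenness of \<open>g\<close>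
  makes the exponential series a cosine series.\<close>

definition H2_bounded :: "(real \<Rightarrow> real) \<Rightarrow> real \<Rightarrow> bool" where
  "H2_bounded f B \<longleftrightarrow> (\<exists>g :: int \<Rightarrow> real.
     (\<forall>n. g (- n) = g n) \<and>
     (\<lambda>n. (1 + (of_int n)\<^sup>2) * \<bar>g n\<bar>) summable_on UNIV \<and>
     (\<Sum>\<^sub>\<infinity>n. (1 + (of_int n)\<^sup>2) * \<bar>g n\<bar>) \<le> B \<and>
     (\<forall>z. ((\<lambda>n. complex_of_real (g n) * cis (of_int n * z)) has_sum complex_of_real (f z)) UNIV))"

lemma cis_int_periodic: "cis (of_int n * (z + 2 * pi)) = cis (of_int n * z)"
proof -
  have "cis (of_int n * (z + 2 * pi)) = cis (of_int n * z) * cis (2 * pi * of_int n)"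
    by (simp add: cis_mult algebra_simps)
  then show ?thesis by (simp add: cis_multiple_2pi)
qed

lemma integral_cis_int:
  "((\<lambda>z. cis (of_int n * z)) has_integral (if n = 0 then 2 * pi else 0)) {-pi..pi}"
proof (cases "n = 0")
  case True
  then show ?thesis using has_integral_const_real[of "1::complex" "-pi" pi]
    by (simp add: scaleR_conv_of_real)
next
  case False
  define F where "F z = cis (of_int n * z) / (\<i> * of_int n)" for z
  have "((\<lambda>z. cis (of_int n * z)) has_integral (F pi - F (-pi))) {-pi..pi}"
  proof (rule fundamental_theorem_of_calculus)
    fix x assume "x \<in> {-pi..pi}"
    show "(F has_vector_derivative cis (of_int n * x)) (at x within {-pi..pi})"
    proof -
      have "((\<lambda>z. exp (\<i> * of_int n * z) / (\<i> * of_int n)) has_field_derivative exp (\<i> * of_int n * of_real x)) (at (of_real x))"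
        using False by (auto intro!: derivative_eq_intros)
      from has_vector_derivative_real_field[OF this] show ?thesis
        by (simp add: F_def[abs_def] cis_conv_exp mult_ac)
    qed
  qed simp
  moreover have "F pi = F (-pi)"
    using cis_int_periodic[of n "-pi"] by (simp add: F_def)
  ultimately show ?thesis using False by simp
qed

lemma weighted_summable_imp_summable:
  fixes g :: "int \<Rightarrow> real"
  assumes "(\<lambda>n. (1 + (of_int n)\<^sup>2) * \<bar>g n\<bar>) summable_on UNIV"
  shows "(\<lambda>n. \<bar>g n\<bar>) summable_on UNIV"
  by (rule summable_on_comparison_test[OF assms]) (auto simp: algebra_simps)

lemma cis_series_uniform:
  fixes g :: "int \<Rightarrow> real"
  assumes "(\<lambda>n. \<bar>g n\<bar>) summable_on UNIV"
    and "\<And>z. ((\<lambda>n. complex_of_real (g n) * cis (of_int n * z)) has_sum f z) UNIV"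
  shows "uniform_limit S (\<lambda>X z. \<Sum>n\<in>X. complex_of_real (g n) * cis (of_int n * z)) f (finite_subsets_at_top UNIV)"
  by (rule Weierstrass_m_test_general'[where M = "\<lambda>n. \<bar>g n\<bar>"]) (use assms in \<open>auto simp: norm_mult\<close>)

text \<open>The series converges uniformly by the Weierstrass test, so it may be integrated term by term; among the
  partial sums it suffices to look at those whose index set contains \<open>m\<close>, by orthogonality.\<close>

lemma fourier_coeff_cis_series:
  fixes g :: "int \<Rightarrow> real"
  assumes "(\<lambda>n. \<bar>g n\<bar>) summable_on UNIV"
    and "\<And>z. ((\<lambda>n. complex_of_real (g n) * cis (of_int n * z)) has_sum complex_of_real (f z)) UNIV"
  shows "fourier_coeff f m = g m"
proof -
  define \<phi> where "\<phi> = (\<lambda>n z. complex_of_real (g n) * cis (of_int (n - m) * z))"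
  have \<phi>: "\<phi> n z = complex_of_real (g n) * cis (of_int n * z) * cis (- (of_int m * z))" for n z
    by (simp add: \<phi>_def mult.assoc cis_mult algebra_simps)
  have "uniform_limit {-pi..pi} (\<lambda>X z. \<Sum>n\<in>X. \<phi> n z) (\<lambda>z. complex_of_real (f z) * cis (- (of_int m * z))) (finite_subsets_at_top UNIV)"
  proof (rule Weierstrass_m_test_general'[where M = "\<lambda>n. \<bar>g n\<bar>"])
    show "((\<lambda>n. \<phi> n z) has_sum complex_of_real (f z) * cis (- (of_int m * z))) UNIV" for z
      unfolding \<phi> by (intro has_sum_cmult_left assms)
  qed (use assms(1) in \<open>auto simp: norm_mult \<phi>_def\<close>)
  then obtain I J where I: "\<And>X. ((\<lambda>z. \<Sum>n\<in>X. \<phi> n z) has_integral I X) {-pi..pi}"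
    and J: "((\<lambda>z. complex_of_real (f z) * cis (- (of_int m * z))) has_integral J) {-pi..pi}"
    and lim: "(I \<longlongrightarrow> J) (finite_subsets_at_top UNIV)"
    by (rule uniform_limit_integral) (auto simp: \<phi>_def cis_conv_exp intro!: continuous_intros)
  have "I X = 2 * pi * g m" if "finite X" "m \<in> X" for X
  proof -
    have "((\<lambda>z. \<Sum>n\<in>X. \<phi> n z) has_integral (\<Sum>n\<in>X. complex_of_real (g n) * (if n - m = 0 then 2 * pi else 0))) {-pi..pi}"
      unfolding \<phi>_def using that by (intro has_integral_sum has_integral_mult_right integral_cis_int) auto
    moreover have "(\<Sum>n\<in>X. complex_of_real (g n) * (if n - m = 0 then 2 * pi else 0)) = 2 * pi * g m"
      using that by (simp add: if_distrib sum.delta cong: if_cong)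
    ultimately show ?thesis using I has_integral_unique by metis
  qed
  then have "eventually (\<lambda>X. I X = 2 * pi * g m) (finite_subsets_at_top UNIV)"
    unfolding eventually_finite_subsets_at_top by (intro exI[of _ "{m}"]) auto
  then have "(I \<longlongrightarrow> 2 * pi * g m) (finite_subsets_at_top UNIV)" by (rule tendsto_eventually)
  then have "J = 2 * pi * g m" using lim by (intro tendsto_unique[OF _ lim]) auto
  then show ?thesis using J by (simp add: fourier_coeff_def integral_unique)
qed

text \<open>With \<open>w n = (1 + n\<^sup>2) \<bar>g n\<bar>\<close> and \<open>S = \<Sum> w\<close>, each \<open>w n \<le> S\<close>, hence \<open>\<Sum> w\<^sup>2 \<le> S \<Sum> w = S\<^sup>2\<close>.\<close>

lemma H2_boundedD:
  assumes "H2_bounded f B"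
  shows "f \<in> H2_even" "H2_norm f \<le> B"
proof -
  obtain g where ev: "\<And>n. g (- n) = g n"
    and sm: "(\<lambda>n::int. (1 + (of_int n)\<^sup>2) * \<bar>g n\<bar>) summable_on UNIV"
    and le: "(\<Sum>\<^sub>\<infinity>n::int. (1 + (of_int n)\<^sup>2) * \<bar>g n\<bar>) \<le> B"
    and fs: "\<And>z. ((\<lambda>n. complex_of_real (g n) * cis (of_int n * z)) has_sum complex_of_real (f z)) UNIV"
    using assms unfolding H2_bounded_def by auto
  note abs = weighted_summable_imp_summable[OF sm]
  have fc: "cmod (fourier_coeff f n) = \<bar>g n\<bar>" for n
    using fourier_coeff_cis_series[OF abs fs, of n] by simp
  define w where "w = (\<lambda>n::int. (1 + (of_int n)\<^sup>2) * \<bar>g n\<bar>)"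
  define S where "S = (\<Sum>\<^sub>\<infinity>n. w n)"
  have w0: "w n \<ge> 0" for n by (simp add: w_def)
  have ws: "w summable_on UNIV" using sm by (simp add: w_def)
  have wS: "w n \<le> S" for n
    using finite_sum_le_infsum[OF ws, of "{n}"] w0 by (simp add: S_def)
  have sq: "(1 + (of_int n)\<^sup>2)\<^sup>2 * (cmod (fourier_coeff f n))\<^sup>2 = w n * w n" for n
    unfolding fc w_def by (simp add: power2_eq_square mult_ac)
  have S0: "S \<ge> 0" using w0[of 0] wS[of 0] by linarith
  have le2: "w n * w n \<le> S * w n" for n using w0 wS by (intro mult_right_mono) auto
  have sS: "(\<lambda>n. S * w n) summable_on UNIV" by (intro summable_on_cmult_right ws)
  have s2: "(\<lambda>n. w n * w n) summable_on UNIV"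
    by (rule summable_on_comparison_test[OF sS]) (use le2 w0 in auto)
  have "(\<Sum>\<^sub>\<infinity>n. w n * w n) \<le> (\<Sum>\<^sub>\<infinity>n. S * w n)" by (intro infsum_mono s2 sS le2)
  also have "\<dots> = S\<^sup>2" using ws by (simp add: infsum_cmult_right S_def power2_eq_square)
  finally have "H2_norm f \<le> sqrt (S\<^sup>2)" unfolding H2_norm_def sq by (rule real_sqrt_le_mono)
  then show "H2_norm f \<le> B" using S0 le by (simp add: S_def w_def)
  have "continuous_on UNIV (\<lambda>z. complex_of_real (f z))"
    by (rule uniform_limit_theorem[OF _ cis_series_uniform[OF abs fs]])
       (auto simp: cis_conv_exp intro!: always_eventually continuous_intros)
  then have "continuous_on UNIV (\<lambda>z. Re (complex_of_real (f z)))" by (rule continuous_on_Re)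
  then have "continuous_on UNIV f" by simp
  moreover have "f (z + 2 * pi) = f z" for z
    using has_sum_unique[OF fs[of z] fs[of "z + 2 * pi", unfolded cis_int_periodic]] by simp
  moreover have "f (- z) = f z" for z
  proof -
    have "((\<lambda>n. complex_of_real (g n) * cis (of_int n * (- z))) has_sum complex_of_real (f z)) UNIV"
      by (rule has_sum_reindex_bij_witness[THEN iffD1, OF _ _ _ _ _ _ fs[of z], of uminus uminus])
         (auto simp: ev)
    from has_sum_unique[OF fs[of "- z"] this] show ?thesis by simp
  qed
  ultimately show "f \<in> H2_even" using s2 by (auto simp: H2_even_def sq)
qed

lemma H2_bounded_cmult:
  assumes "H2_bounded f B"
  shows "H2_bounded (\<lambda>z. c * f z) (\<bar>c\<bar> * B)"
proof -
  obtain g where g: "\<And>n. g (- n) = g n"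
    "(\<lambda>n::int. (1 + (of_int n)\<^sup>2) * \<bar>g n\<bar>) summable_on UNIV"
    "(\<Sum>\<^sub>\<infinity>n::int. (1 + (of_int n)\<^sup>2) * \<bar>g n\<bar>) \<le> B"
    "\<And>z. ((\<lambda>n. complex_of_real (g n) * cis (of_int n * z)) has_sum complex_of_real (f z)) UNIV"
    using assms unfolding H2_bounded_def by auto
  have eq: "(1 + (of_int n)\<^sup>2) * \<bar>c * g n\<bar> = \<bar>c\<bar> * ((1 + (of_int n)\<^sup>2) * \<bar>g n\<bar>)" for n :: int
    by (simp add: abs_mult)
  show ?thesis unfolding H2_bounded_def
  proof (intro exI[of _ "\<lambda>n. c * g n"] conjI allI)
    show "(\<lambda>n::int. (1 + (of_int n)\<^sup>2) * \<bar>c * g n\<bar>) summable_on UNIV"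
      unfolding eq by (intro summable_on_cmult_right g)
    show "(\<Sum>\<^sub>\<infinity>n::int. (1 + (of_int n)\<^sup>2) * \<bar>c * g n\<bar>) \<le> \<bar>c\<bar> * B"
      unfolding eq using g(2,3) by (simp add: infsum_cmult_right mult_left_mono)
    show "((\<lambda>n. complex_of_real (c * g n) * cis (of_int n * z)) has_sum complex_of_real (c * f z)) UNIV" for z
      using has_sum_cmult_right[OF g(4)[of z], of "of_real c"] by (simp add: mult.assoc)
  qed (simp add: g(1))
qed

lemma H2_bounded_mono:
  assumes "H2_bounded f B" "B \<le> B'"
  shows "H2_bounded f B'"
proof -
  obtain g where g: "\<And>n. g (- n) = g n"
    "(\<lambda>n::int. (1 + (of_int n)\<^sup>2) * \<bar>g n\<bar>) summable_on UNIV"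
    "(\<Sum>\<^sub>\<infinity>n::int. (1 + (of_int n)\<^sup>2) * \<bar>g n\<bar>) \<le> B"
    "\<And>z. ((\<lambda>n. complex_of_real (g n) * cis (of_int n * z)) has_sum complex_of_real (f z)) UNIV"
    using assms unfolding H2_bounded_def by auto
  show ?thesis unfolding H2_bounded_def
    by (rule exI[of _ g]) (use g order.trans[OF g(3) assms(2)] in simp)
qed

lemma H2_bounded_abs_le:
  assumes "H2_bounded f B"
  shows "\<bar>f z\<bar> \<le> B"
proof -
  obtain g where sm: "(\<lambda>n::int. (1 + (of_int n)\<^sup>2) * \<bar>g n\<bar>) summable_on UNIV"
    and le: "(\<Sum>\<^sub>\<infinity>n::int. (1 + (of_int n)\<^sup>2) * \<bar>g n\<bar>) \<le> B"
    and fs: "\<And>z. ((\<lambda>n. complex_of_real (g n) * cis (of_int n * z)) has_sum complex_of_real (f z)) UNIV"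
    using assms unfolding H2_bounded_def by auto
  note ab = weighted_summable_imp_summable[OF sm]
  have "((\<lambda>n. norm (complex_of_real (g n) * cis (of_int n * z))) has_sum (\<Sum>\<^sub>\<infinity>n. \<bar>g n\<bar>)) UNIV"
    using has_sum_infsum[OF ab] by (simp add: norm_mult)
  from norm_has_sum_bound[OF this fs]
  have "\<bar>f z\<bar> \<le> (\<Sum>\<^sub>\<infinity>n. \<bar>g n\<bar>)" by simp
  also have "\<dots> \<le> (\<Sum>\<^sub>\<infinity>n::int. (1 + (of_int n)\<^sup>2) * \<bar>g n\<bar>)"
    by (rule infsum_mono[OF ab sm]) (simp add: algebra_simps)
  finally show ?thesis using le by simp
qed

text \<open>Completeness in the form needed below: the coefficients of the sum are the sums of the coefficients, and
  Fubini for absolutely summable families exchanges the sum over \<open>i\<close> with the Fourier series.\<close>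

lemma H2_bounded_infsum:
  fixes f :: "'i \<Rightarrow> real \<Rightarrow> real"
  assumes f: "\<And>i. i \<in> I \<Longrightarrow> H2_bounded (f i) (B i)"
    and B: "B summable_on I"
    and F: "\<And>z. ((\<lambda>i. f i z) has_sum F z) I"
  shows "H2_bounded F (infsum B I)"
proof -
  define w where "w n = 1 + (real_of_int n)\<^sup>2" for n
  have w1: "w n \<ge> 1" and wp: "w n \<ge> 0" for n by (simp_all add: w_def)
  have "\<forall>i\<in>I. \<exists>g. (\<forall>n. g (- n) = g n) \<and> (\<lambda>n. w n * \<bar>g n\<bar>) summable_on UNIV \<and>
     (\<Sum>\<^sub>\<infinity>n. w n * \<bar>g n\<bar>) \<le> B i \<and>
     (\<forall>z. ((\<lambda>n. complex_of_real (g n) * cis (of_int n * z)) has_sum complex_of_real (f i z)) UNIV)"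
    using f unfolding H2_bounded_def w_def by blast
  then obtain g where "\<forall>i\<in>I. (\<forall>n. g i (- n) = g i n) \<and> (\<lambda>n. w n * \<bar>g i n\<bar>) summable_on UNIV \<and>
     (\<Sum>\<^sub>\<infinity>n. w n * \<bar>g i n\<bar>) \<le> B i \<and>
     (\<forall>z. ((\<lambda>n. complex_of_real (g i n) * cis (of_int n * z)) has_sum complex_of_real (f i z)) UNIV)"
    by (rule bchoice[THEN exE])
  then have ev: "\<And>i n. i \<in> I \<Longrightarrow> g i (- n) = g i n"
    and sm: "\<And>i. i \<in> I \<Longrightarrow> (\<lambda>n. w n * \<bar>g i n\<bar>) summable_on UNIV"
    and le: "\<And>i. i \<in> I \<Longrightarrow> (\<Sum>\<^sub>\<infinity>n. w n * \<bar>g i n\<bar>) \<le> B i"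
    and fs: "\<And>i z. i \<in> I \<Longrightarrow> ((\<lambda>n. complex_of_real (g i n) * cis (of_int n * z)) has_sum complex_of_real (f i z)) UNIV"
    by auto
  have gw: "\<bar>g i n\<bar> \<le> w n * \<bar>g i n\<bar>" for i n
    using mult_right_mono[OF w1[of n], of "\<bar>g i n\<bar>"] by simp
  define N where "N i = (\<Sum>\<^sub>\<infinity>n. w n * \<bar>g i n\<bar>)" for i
  have N: "((\<lambda>n. w n * \<bar>g i n\<bar>) has_sum N i) UNIV" if "i \<in> I" for i
    using sm[OF that] by (simp add: N_def)
  have N0: "N i \<ge> 0" for i unfolding N_def using wp by (intro infsum_nonneg mult_nonneg_nonneg) auto
  have Ns: "N summable_on I"
    by (rule summable_on_comparison_test[OF B]) (use le N0 in \<open>auto simp: N_def\<close>)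
  \<comment> \<open>Fubini on \<open>I \<times> UNIV\<close>, first for the weighted absolute values\<close>
  have SS: "(\<lambda>(i, n). w n * \<bar>g i n\<bar>) summable_on I \<times> UNIV"
    by (rule summable_on_SigmaI[where g = N]) (use Ns in \<open>simp_all add: N wp\<close>)
  have SS': "(\<lambda>(n, i). w n * \<bar>g i n\<bar>) summable_on UNIV \<times> I"
    using summable_on_swap[THEN iffD1, OF SS] by (simp add: case_prod_unfold)
  have Sg: "(\<lambda>(i, n). \<bar>g i n\<bar>) summable_on I \<times> UNIV"
    by (rule summable_on_comparison_test[OF SS]) (simp_all add: gw split: prod.split)
  have wg: "(\<lambda>i. w n * \<bar>g i n\<bar>) summable_on I" for n
    using summable_on_SigmaD1[OF SS', of n] by simp
  have gn: "(\<lambda>i. \<bar>g i n\<bar>) summable_on I" for n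
    by (rule summable_on_comparison_test[OF wg[of n]]) (simp_all add: gw)
  define G where "G n = (\<Sum>\<^sub>\<infinity>i\<in>I. g i n)" for n
  have G: "((\<lambda>i. g i n) has_sum G n) I" for n
    unfolding G_def by (rule has_sum_infsum, rule abs_summable_summable) (simp add: gn)
  define A where "A n = (\<Sum>\<^sub>\<infinity>i\<in>I. w n * \<bar>g i n\<bar>)" for n
  have A: "((\<lambda>i. w n * \<bar>g i n\<bar>) has_sum A n) I" for n
    unfolding A_def using wg by (rule has_sum_infsum)
  have tot: "((\<lambda>(i, n). w n * \<bar>g i n\<bar>) has_sum (\<Sum>\<^sub>\<infinity>i\<in>I. N i)) (I \<times> UNIV)"
    by (rule has_sum_SigmaI[where g = N]) (use Ns SS in \<open>simp_all add: N\<close>)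
  have At: "(A has_sum (\<Sum>\<^sub>\<infinity>i\<in>I. N i)) UNIV"
    by (rule has_sum_SigmaD[OF has_sum_swap[THEN iffD1, OF tot]]) (simp add: A)
  have GA: "w n * \<bar>G n\<bar> \<le> A n" for n
  proof -
    have "((\<lambda>i. w n * g i n) has_sum w n * G n) I" by (intro has_sum_cmult_right G)
    then have "norm (w n * G n) \<le> A n"
      by (rule norm_has_sum_bound[rotated]) (use A[of n] w1[of n] in \<open>simp add: abs_mult\<close>)
    then show ?thesis using w1[of n] by (simp add: abs_mult)
  qed
  have w0: "0 \<le> w n * \<bar>G n\<bar>" for n using w1[of n] by simp
  have GS: "(\<lambda>n. w n * \<bar>G n\<bar>) summable_on UNIV"
    by (rule summable_on_comparison_test[OF has_sum_imp_summable[OF At]]) (use GA w0 in auto)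
  have "(\<Sum>\<^sub>\<infinity>n. w n * \<bar>G n\<bar>) \<le> infsum A UNIV"
    by (intro infsum_mono GS GA has_sum_imp_summable[OF At])
  also have "\<dots> = infsum N I" using At by (rule infsumI)
  also have "\<dots> \<le> infsum B I" by (intro infsum_mono Ns B) (simp add: N_def le)
  finally have le': "(\<Sum>\<^sub>\<infinity>n. w n * \<bar>G n\<bar>) \<le> infsum B I" .
  show ?thesis unfolding H2_bounded_def
  proof (intro exI[of _ G] conjI allI)
    show "G (- n) = G n" for n unfolding G_def by (intro infsum_cong ev)
    show "((\<lambda>n. complex_of_real (G n) * cis (of_int n * z)) has_sum complex_of_real (F z)) UNIV" for z
    proof -
      have "(\<lambda>(i, n). complex_of_real (g i n) * cis (of_int n * z)) summable_on I \<times> UNIV"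
        by (rule abs_summable_summable) (use Sg in \<open>simp add: norm_mult case_prod_unfold\<close>)
      then have "((\<lambda>(i, n). complex_of_real (g i n) * cis (of_int n * z)) has_sum complex_of_real (F z)) (I \<times> UNIV)"
        by (intro has_sum_SigmaI[where g = "\<lambda>i. complex_of_real (f i z)"])
           (use fs F in \<open>auto simp: has_sum_of_real_iff\<close>)
      from has_sum_swap[THEN iffD1, OF this]
      have "((\<lambda>(n, i). complex_of_real (g i n) * cis (of_int n * z)) has_sum complex_of_real (F z)) (UNIV \<times> I)"
        by (simp add: case_prod_unfold)
      then show ?thesis
        by (rule has_sum_SigmaD) (auto intro!: has_sum_cmult_left simp: has_sum_of_real_iff G)
    qed
  qed (use GS le' in \<open>auto simp: w_def\<close>)
qed

lemma H2_bounded_cos_poly: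
  assumes "\<And>n. g (- n) = g n" "finite N" "\<And>n. n \<in> N \<Longrightarrow> - n \<in> N"
  shows "H2_bounded (\<lambda>z. \<Sum>n\<in>N. g n * cos (of_int n * z)) (\<Sum>n\<in>N. (1 + (of_int n)\<^sup>2) * \<bar>g n\<bar>)"
  unfolding H2_bounded_def
proof (intro exI[of _ "\<lambda>n. if n \<in> N then g n else 0"] conjI allI)
  have "((\<lambda>n. (1 + (of_int n)\<^sup>2) * \<bar>if n \<in> N then g n else 0\<bar>) has_sum (\<Sum>n\<in>N. (1 + (of_int n)\<^sup>2) * \<bar>g n\<bar>)) UNIV"
    by (rule has_sum_finite_neutralI[OF assms(2)]) auto
  then show "(\<lambda>n. (1 + (of_int n)\<^sup>2) * \<bar>if n \<in> N then g n else 0\<bar>) summable_on UNIV"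
    "(\<Sum>\<^sub>\<infinity>n. (1 + (of_int n)\<^sup>2) * \<bar>if n \<in> N then g n else 0\<bar>) \<le> (\<Sum>n\<in>N. (1 + (of_int n)\<^sup>2) * \<bar>g n\<bar>)"
    by (auto simp: has_sum_iff)
  fix z
  have "(\<Sum>n\<in>N. g n * sin (of_int n * z)) = (\<Sum>n\<in>N. g (- n) * sin (of_int (- n) * z))"
    by (rule sum.reindex_bij_witness[of _ uminus uminus]) (use assms(3) in auto)
  then have "(\<Sum>n\<in>N. g n * sin (of_int n * z)) = 0" by (simp add: assms(1) sum_negf)
  then have "(\<Sum>n\<in>N. complex_of_real (g n) * cis (of_int n * z)) = complex_of_real (\<Sum>n\<in>N. g n * cos (of_int n * z))"
    by (simp add: complex_eq_iff)
  then show "((\<lambda>n. complex_of_real (if n \<in> N then g n else 0) * cis (of_int n * z)) has_sum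
      complex_of_real (\<Sum>n\<in>N. g n * cos (of_int n * z))) UNIV"
    by (intro has_sum_finite_neutralI[OF assms(2)]) auto
  show "(if - n \<in> N then g (- n) else 0) = (if n \<in> N then g n else 0)" for n
    using assms(1)[of n] assms(3)[of n] assms(3)[of "- n"] by auto
qed

section \<open>Double power series of sums of monomials\<close>

lemma H2_norm_nonneg: "H2_norm f \<ge> 0"
  unfolding H2_norm_def by (intro real_sqrt_ge_zero infsum_nonneg) auto

text \<open>If \<open>\<phi>\<^sub>m\<close> has an expansion \<open>\<Sum>\<^sub>i \<xi>\<^sub>i w\<^sub>m\<^sub>i\<close> with majorant \<open>D\<^sub>m\<close> on the polydisc \<open>\<bar>\<xi>\<^sub>i\<bar> \<le> R\<^sub>i\<close>, then so has
  \<open>\<Sum>\<^sub>m \<phi>\<^sub>m v\<^sub>m\<close>, by Fubini on the pairs \<open>(m, i)\<close>. The two summability statements do not involve \<open>v\<close>; they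
  provide norm bounds for the new coefficients, whereas the last statement is applied to \<open>v\<^sub>m = f\<^sub>m z\<close> for
  each \<open>z\<close> separately.\<close>

lemma series_rearrangement:
  fixes w :: "'m \<Rightarrow> 'i \<Rightarrow> real"
  assumes w: "\<And>m. ((\<lambda>i. \<bar>w m i\<bar> * R i) has_sum D m) UNIV"
    and DN: "(\<lambda>m. D m * N m) summable_on UNIV"
    and R: "\<And>i. R i > 0" and N: "\<And>m. N m \<ge> 0"
  shows "(\<lambda>m. \<bar>w m i\<bar> * N m) summable_on UNIV"
    and "(\<lambda>i. R i * (\<Sum>\<^sub>\<infinity>m. \<bar>w m i\<bar> * N m)) summable_on UNIV"
    and "\<lbrakk>\<And>i. \<bar>\<xi> i\<bar> \<le> R i; \<And>m. \<bar>v m\<bar> \<le> N m; \<And>m. ((\<lambda>i. \<xi> i * w m i) has_sum \<phi> m) UNIV\<rbrakk>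
      \<Longrightarrow> ((\<lambda>i. \<xi> i * (\<Sum>\<^sub>\<infinity>m. w m i * v m)) has_sum (\<Sum>\<^sub>\<infinity>m. \<phi> m * v m)) UNIV"
proof -
  have T: "(\<lambda>(m, i). \<bar>w m i\<bar> * R i * N m) summable_on UNIV \<times> UNIV"
    by (rule summable_on_SigmaI[OF _ DN]) (use less_imp_le[OF R] N in \<open>auto intro!: has_sum_cmult_left w mult_nonneg_nonneg\<close>)
  have T': "(\<lambda>(i, m). \<bar>w m i\<bar> * R i * N m) summable_on UNIV \<times> UNIV"
    using summable_on_swap[THEN iffD1, OF T] by (simp add: case_prod_unfold)
  show S: "(\<lambda>m. \<bar>w m i\<bar> * N m) summable_on UNIV" for i
  proof -
    have "(\<lambda>m. inverse (R i) * (\<bar>w m i\<bar> * R i * N m)) summable_on UNIV"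
      using summable_on_SigmaD1[OF T', of i] by (intro summable_on_cmult_right) simp
    then show ?thesis using R[of i] by (simp add: field_simps)
  qed
  have E: "((\<lambda>m. \<bar>w m i\<bar> * R i * N m) has_sum R i * (\<Sum>\<^sub>\<infinity>m. \<bar>w m i\<bar> * N m)) UNIV" for i
    using has_sum_cmult_right[OF has_sum_infsum[OF S[of i]], of "R i"] by (simp add: mult_ac)
  show "(\<lambda>i. R i * (\<Sum>\<^sub>\<infinity>m. \<bar>w m i\<bar> * N m)) summable_on UNIV"
    by (rule has_sum_imp_summable, rule has_sum_SigmaD[OF has_sum_infsum[OF T']]) (use E in auto)
  assume \<xi>: "\<And>i. \<bar>\<xi> i\<bar> \<le> R i" and v: "\<And>m. \<bar>v m\<bar> \<le> N m"
    and \<phi>: "\<And>m. ((\<lambda>i. \<xi> i * w m i) has_sum \<phi> m) UNIV"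
  have "(\<lambda>(m, i). \<xi> i * w m i * v m) summable_on UNIV \<times> UNIV"
  proof (rule abs_summable_summable, rule summable_on_comparison_test[OF T])
    fix mi :: "'m \<times> 'i"
    obtain m i where mi: "mi = (m, i)" by fastforce
    have "\<bar>w m i\<bar> * \<bar>\<xi> i\<bar> * \<bar>v m\<bar> \<le> \<bar>w m i\<bar> * R i * N m"
      using \<xi> v R[of i] by (intro mult_mono) (auto intro: less_imp_le)
    then show "norm (case mi of (m, i) \<Rightarrow> \<xi> i * w m i * v m) \<le> (case mi of (m, i) \<Rightarrow> \<bar>w m i\<bar> * R i * N m)"
      by (simp add: mi abs_mult mult_ac)
  qed auto
  then obtain S where S1: "((\<lambda>(m, i). \<xi> i * w m i * v m) has_sum S) (UNIV \<times> UNIV)"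
    by (auto simp: summable_on_def)
  have "((\<lambda>m. \<phi> m * v m) has_sum S) UNIV"
    by (rule has_sum_SigmaD[OF S1]) (auto intro!: has_sum_cmult_left \<phi>)
  then have "S = (\<Sum>\<^sub>\<infinity>m. \<phi> m * v m)" by (simp add: infsumI)
  have "((\<lambda>(i, m). \<xi> i * w m i * v m) has_sum S) (UNIV \<times> UNIV)"
    using has_sum_swap[THEN iffD1, OF S1] by (simp add: case_prod_unfold)
  then have "((\<lambda>i. \<xi> i * (\<Sum>\<^sub>\<infinity>m. w m i * v m)) has_sum S) UNIV"
  proof (rule has_sum_SigmaD)
    fix i
    have "(\<lambda>m. w m i * v m) summable_on UNIV"
      by (rule abs_summable_summable, rule summable_on_comparison_test[OF S[of i]])
         (use v in \<open>auto simp: abs_mult intro!: mult_left_mono\<close>)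
    from has_sum_cmult_right[OF has_sum_infsum[OF this], of "\<xi> i"]
    show "((\<lambda>m. case (i, m) of (i, m) \<Rightarrow> \<xi> i * w m i * v m) has_sum \<xi> i * (\<Sum>\<^sub>\<infinity>m. w m i * v m)) UNIV"
      by (simp add: mult_ac)
  qed
  then show "((\<lambda>i. \<xi> i * (\<Sum>\<^sub>\<infinity>m. w m i * v m)) has_sum (\<Sum>\<^sub>\<infinity>m. \<phi> m * v m)) UNIV"
    using \<open>S = _\<close> by simp
qed

text \<open>The Taylor coefficients of \<open>a\<^sup>m k\<^sup>s\<close> at the point \<open>(a, k)\<close>.\<close>

definition taylor_monomial :: "real \<Rightarrow> real \<Rightarrow> nat \<Rightarrow> nat \<Rightarrow> nat \<times> nat \<Rightarrow> real" where
  "taylor_monomial a k m s = (\<lambda>(p, q). (of_nat (m choose p) * a ^ (m - p)) * (of_nat (s choose q) * k ^ (s - q)))"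

lemma taylor_monomial_has_sum:
  "((\<lambda>(p, q). x ^ p * y ^ q * taylor_monomial a k m s (p, q)) has_sum (x + a) ^ m * (y + k) ^ s) UNIV"
proof (rule has_sum_finite_neutralI[where B = "{..m} \<times> {..s}"])
  show "(x + a) ^ m * (y + k) ^ s = (\<Sum>(p, q)\<in>{..m} \<times> {..s}. x ^ p * y ^ q * taylor_monomial a k m s (p, q))"
    unfolding binomial_ring sum_product sum.cartesian_product
    by (intro sum.cong refl) (auto simp: taylor_monomial_def)
qed (auto simp: taylor_monomial_def)

text \<open>The amplitude that remains after scaling is \<open>k\<^sup>2 a\<close>, so \<open>\<rho>\<close> bounds the scaled amplitude.\<close>

definition wave_domain :: "real \<Rightarrow> (real \<times> real) set" where
  "wave_domain \<rho> = {(a, k). 0 < k \<and> \<bar>a\<bar> * k\<^sup>2 < \<rho>}"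

lemma open_wave_domain: "open (wave_domain \<rho>)"
proof -
  have "wave_domain \<rho> = {p. 0 < snd p} \<inter> {p. \<bar>fst p\<bar> * (snd p)\<^sup>2 < \<rho>}"
    by (auto simp: wave_domain_def)
  then show ?thesis
    by (auto intro!: open_Int open_Collect_less continuous_intros)
qed

text \<open>The defining inequality is monotone in \<open>\<bar>a\<bar>\<close> and \<open>k\<close>, so once the outer corner \<open>(\<bar>a0\<bar> + r, k0 + r)\<close> lies in
  the domain the whole square does; the corner also carries the majorant of the re-expanded series.\<close>

lemma wave_domain_polydisc:
  assumes "(a0, k0) \<in> wave_domain \<rho>"
  obtains r where "r > 0" "r < k0" "(\<bar>a0\<bar> + r, k0 + r) \<in> wave_domain \<rho>"
    "\<forall>a k. \<bar>a - a0\<bar> < r \<and> \<bar>k - k0\<bar> < r \<longrightarrow> (a, k) \<in> wave_domain \<rho>"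
proof -
  have k0: "k0 > 0" and a0: "\<bar>a0\<bar> * k0\<^sup>2 < \<rho>" using assms by (auto simp: wave_domain_def)
  have "((\<lambda>r. (\<bar>a0\<bar> + r) * (k0 + r)\<^sup>2) \<longlongrightarrow> (\<bar>a0\<bar> + 0) * (k0 + 0)\<^sup>2) (at_right 0)"
    by (intro tendsto_intros)
  then have "eventually (\<lambda>r. (\<bar>a0\<bar> + r) * (k0 + r)\<^sup>2 < \<rho>) (at_right 0)"
    using a0 by (intro order_tendstoD(2)) auto
  moreover have "eventually (\<lambda>r. r < k0) (at_right 0)" using k0 by (intro order_tendstoD(2)[OF tendsto_ident_at])
  moreover have "eventually (\<lambda>r::real. r > 0) (at_right 0)" by (rule eventually_at_right_less)
  ultimately have "eventually (\<lambda>r. (\<bar>a0\<bar> + r) * (k0 + r)\<^sup>2 < \<rho> \<and> r < k0 \<and> r > 0) (at_right 0)"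
    by eventually_elim auto
  then obtain r where r: "(\<bar>a0\<bar> + r) * (k0 + r)\<^sup>2 < \<rho>" "r < k0" "r > 0"
    using eventually_happens'[OF trivial_limit_at_right_real] by blast
  show thesis
  proof (rule that[OF r(3,2)])
    show "(\<bar>a0\<bar> + r, k0 + r) \<in> wave_domain \<rho>" using r k0 by (auto simp: wave_domain_def)
    show "\<forall>a k. \<bar>a - a0\<bar> < r \<and> \<bar>k - k0\<bar> < r \<longrightarrow> (a, k) \<in> wave_domain \<rho>"
    proof (intro allI impI)
      fix a k assume *: "\<bar>a - a0\<bar> < r \<and> \<bar>k - k0\<bar> < r"
      then have "\<bar>a\<bar> * k\<^sup>2 \<le> (\<bar>a0\<bar> + r) * (k0 + r)\<^sup>2"
        using r by (intro mult_mono power_mono) auto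
      then show "(a, k) \<in> wave_domain \<rho>" using * r by (auto simp: wave_domain_def)
    qed
  qed
qed

text \<open>The common core of the real-valued and the \<open>H\<^sup>2\<close>-valued case: the coefficients \<open>w\<close> depend on the base
  point only, so the same expansion holds for all sequences \<open>v\<close> dominated by \<open>N\<close>. The majorant of the
  re-expanded monomials is their value at the outer corner.\<close>

lemma monomial_series_expansion:
  fixes N :: "nat \<Rightarrow> real" and s :: "nat \<Rightarrow> nat"
  assumes N: "\<And>m. N m \<ge> 0"
    and S: "\<And>a k. (a, k) \<in> wave_domain \<rho> \<Longrightarrow> (\<lambda>m. \<bar>a\<bar> ^ m * k ^ s m * N m) summable_on UNIV"
    and dom: "(a0, k0) \<in> wave_domain \<rho>"
  obtains r w where "r > 0"
    "\<forall>a k. \<bar>a - a0\<bar> < r \<and> \<bar>k - k0\<bar> < r \<longrightarrow> (a, k) \<in> wave_domain \<rho>"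
    "\<forall>i. (\<lambda>m. \<bar>w m i\<bar> * N m) summable_on UNIV"
    "(\<lambda>i. (r ^ fst i * r ^ snd i) * (\<Sum>\<^sub>\<infinity>m. \<bar>w m i\<bar> * N m)) summable_on (UNIV :: (nat \<times> nat) set)"
    "\<forall>a k v. \<bar>a - a0\<bar> < r \<and> \<bar>k - k0\<bar> < r \<and> (\<forall>m. \<bar>v m\<bar> \<le> N m) \<longrightarrow>
       ((\<lambda>i. ((a - a0) ^ fst i * (k - k0) ^ snd i) * (\<Sum>\<^sub>\<infinity>m. w m i * v m)) has_sum (\<Sum>\<^sub>\<infinity>m. a ^ m * k ^ s m * v m)) (UNIV :: (nat \<times> nat) set)"
proof -
  obtain r where r: "r > 0" "r < k0" "(\<bar>a0\<bar> + r, k0 + r) \<in> wave_domain \<rho>"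
    "\<forall>a k. \<bar>a - a0\<bar> < r \<and> \<bar>k - k0\<bar> < r \<longrightarrow> (a, k) \<in> wave_domain \<rho>"
    by (rule wave_domain_polydisc[OF dom]) (rule that)
  define w where "w m = taylor_monomial a0 k0 m (s m)" for m
  have k0: "k0 > 0" using r by linarith
  have "\<bar>w m i\<bar> = taylor_monomial \<bar>a0\<bar> k0 m (s m) i" for m i
    using k0 by (auto simp: w_def taylor_monomial_def abs_mult power_abs split: prod.split)
  then have W: "((\<lambda>i. \<bar>w m i\<bar> * (r ^ fst i * r ^ snd i)) has_sum (\<bar>a0\<bar> + r) ^ m * (k0 + r) ^ s m) UNIV" for m
    using taylor_monomial_has_sum[of r r "\<bar>a0\<bar>" k0 m "s m"]
    by (simp add: case_prod_unfold mult.commute add.commute)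
  have DN: "(\<lambda>m. (\<bar>a0\<bar> + r) ^ m * (k0 + r) ^ s m * N m) summable_on UNIV"
    using S[OF r(3)] r(1) by simp
  have R: "r ^ fst i * r ^ snd i > 0" for i :: "nat \<times> nat" using r(1) by simp
  note L = series_rearrangement[of w "\<lambda>i. r ^ fst i * r ^ snd i", OF W DN R N]
  show thesis
  proof (rule that[OF r(1,4) _ L(2)]; intro allI impI L(1))
    fix a k and v :: "nat \<Rightarrow> real"
    assume "\<bar>a - a0\<bar> < r \<and> \<bar>k - k0\<bar> < r \<and> (\<forall>m. \<bar>v m\<bar> \<le> N m)"
    then have *: "\<bar>a - a0\<bar> < r" "\<bar>k - k0\<bar> < r" and v: "\<And>m. \<bar>v m\<bar> \<le> N m" by auto
    show "((\<lambda>i. ((a - a0) ^ fst i * (k - k0) ^ snd i) * (\<Sum>\<^sub>\<infinity>m. w m i * v m)) has_sum (\<Sum>\<^sub>\<infinity>m. a ^ m * k ^ s m * v m)) UNIV"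
    proof (rule L(3)[OF _ v])
      show "\<bar>(a - a0) ^ fst i * (k - k0) ^ snd i\<bar> \<le> r ^ fst i * r ^ snd i" for i
        unfolding abs_mult power_abs using * by (intro mult_mono power_mono) auto
      show "((\<lambda>i. (a - a0) ^ fst i * (k - k0) ^ snd i * w m i) has_sum a ^ m * k ^ s m) UNIV" for m
        using taylor_monomial_has_sum[of "a - a0" "k - k0" a0 k0 m "s m"]
        by (simp add: case_prod_unfold w_def)
    qed
  qed
qed

lemma real_analytic2_on_monomial_series:
  assumes S: "\<And>a k. (a, k) \<in> wave_domain \<rho> \<Longrightarrow> (\<lambda>m. \<bar>a\<bar> ^ m * k ^ s m * \<bar>v m\<bar>) summable_on UNIV"
  shows "real_analytic2_on (\<lambda>a k. \<Sum>\<^sub>\<infinity>m. a ^ m * k ^ s m * v m) (wave_domain \<rho>)"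
  unfolding real_analytic2_on_def
proof safe
  fix a0 k0 assume dom: "(a0, k0) \<in> wave_domain \<rho>"
  obtain r w where r: "r > 0"
    "\<forall>a k. \<bar>a - a0\<bar> < r \<and> \<bar>k - k0\<bar> < r \<longrightarrow> (a, k) \<in> wave_domain \<rho>"
    "\<forall>i. (\<lambda>m. \<bar>w m i\<bar> * \<bar>v m\<bar>) summable_on UNIV"
    "(\<lambda>i. (r ^ fst i * r ^ snd i) * (\<Sum>\<^sub>\<infinity>m. \<bar>w m i\<bar> * \<bar>v m\<bar>)) summable_on (UNIV :: (nat \<times> nat) set)"
    "\<forall>a k u. \<bar>a - a0\<bar> < r \<and> \<bar>k - k0\<bar> < r \<and> (\<forall>m. \<bar>u m\<bar> \<le> \<bar>v m\<bar>) \<longrightarrow>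
       ((\<lambda>i. ((a - a0) ^ fst i * (k - k0) ^ snd i) * (\<Sum>\<^sub>\<infinity>m. w m i * u m)) has_sum (\<Sum>\<^sub>\<infinity>m. a ^ m * k ^ s m * u m)) (UNIV :: (nat \<times> nat) set)"
    by (rule monomial_series_expansion[of "\<lambda>m. \<bar>v m\<bar>", OF abs_ge_zero S dom], assumption) (rule that)
  show "\<exists>r>0. \<exists>e. \<forall>a k. \<bar>a - a0\<bar> < r \<and> \<bar>k - k0\<bar> < r \<longrightarrow> (a, k) \<in> wave_domain \<rho> \<and>
      ((\<lambda>(m, n). (a - a0) ^ m * (k - k0) ^ n * e m n) has_sum (\<Sum>\<^sub>\<infinity>m. a ^ m * k ^ s m * v m)) UNIV"
    using r(1,2) r(5)[THEN spec, THEN spec, THEN spec[of _ v]]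
    by (intro exI[of _ r] conjI exI[of _ "\<lambda>p q. \<Sum>\<^sub>\<infinity>m. w m (p, q) * v m"]) (auto simp: case_prod_unfold)
qed

text \<open>The remainder after a finite partial sum is again an infinite sum of profiles with known bounds, so its
  \<open>H\<^sup>2\<close> norm is at most the tail of the convergent numerical majorant.\<close>

lemma H2_analytic2_on_monomial_series:
  assumes N: "\<And>m. N m \<ge> 0" and f: "\<And>m. H2_bounded (f m) (N m)"
    and S: "\<And>a k. (a, k) \<in> wave_domain \<rho> \<Longrightarrow> (\<lambda>m. \<bar>a\<bar> ^ m * k ^ s m * N m) summable_on UNIV"
  shows "H2_analytic2_on (\<lambda>a k z. \<Sum>\<^sub>\<infinity>m. a ^ m * k ^ s m * f m z) (wave_domain \<rho>)"
  unfolding H2_analytic2_on_def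
proof safe
  fix a0 k0 assume dom: "(a0, k0) \<in> wave_domain \<rho>"
  obtain r w where r: "r > 0"
    "\<forall>a k. \<bar>a - a0\<bar> < r \<and> \<bar>k - k0\<bar> < r \<longrightarrow> (a, k) \<in> wave_domain \<rho>"
    and wS': "\<forall>i. (\<lambda>m. \<bar>w m i\<bar> * N m) summable_on UNIV"
    and wR: "(\<lambda>i. (r ^ fst i * r ^ snd i) * (\<Sum>\<^sub>\<infinity>m. \<bar>w m i\<bar> * N m)) summable_on (UNIV :: (nat \<times> nat) set)"
    and w': "\<forall>a k u. \<bar>a - a0\<bar> < r \<and> \<bar>k - k0\<bar> < r \<and> (\<forall>m. \<bar>u m\<bar> \<le> N m) \<longrightarrow>
       ((\<lambda>i. ((a - a0) ^ fst i * (k - k0) ^ snd i) * (\<Sum>\<^sub>\<infinity>m. w m i * u m)) has_sum (\<Sum>\<^sub>\<infinity>m. a ^ m * k ^ s m * u m)) (UNIV :: (nat \<times> nat) set)"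
    by (rule monomial_series_expansion[of N, OF N S dom], assumption) (rule that)
  note wS = wS'[rule_format] and w = w'[rule_format, OF conjI, OF _ conjI, OF _ _ allI]
  define E where "E i = (\<Sum>\<^sub>\<infinity>m. \<bar>w m i\<bar> * N m)" for i
  define e where "e i z = (\<Sum>\<^sub>\<infinity>m. w m i * f m z)" for i z
  have fle: "\<bar>f m z\<bar> \<le> N m" for m z using H2_bounded_abs_le[OF f] .
  have e: "H2_bounded (e i) (E i)" for i
    unfolding E_def
  proof (rule H2_bounded_infsum[OF _ wS])
    show "H2_bounded (\<lambda>z. w m i * f m z) (\<bar>w m i\<bar> * N m)" for m by (rule H2_bounded_cmult[OF f])
    show "((\<lambda>m. w m i * f m z) has_sum e i z) UNIV" for z
      unfolding e_def
      by (rule has_sum_infsum, rule abs_summable_summable, rule summable_on_comparison_test[OF wS[of i]])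
         (auto simp: abs_mult intro!: mult_left_mono fle)
  qed
  have E0: "E i \<ge> 0" for i unfolding E_def using N by (intro infsum_nonneg) auto
  show "\<exists>r>0. \<exists>e. (\<forall>m n. e m n \<in> H2_even) \<and>
      (\<forall>a k. \<bar>a - a0\<bar> < r \<and> \<bar>k - k0\<bar> < r \<longrightarrow> (a, k) \<in> wave_domain \<rho> \<and>
        (\<lambda>z. \<Sum>\<^sub>\<infinity>m. a ^ m * k ^ s m * f m z) \<in> H2_even \<and>
        ((\<lambda>F. H2_norm (\<lambda>z. (\<Sum>\<^sub>\<infinity>m. a ^ m * k ^ s m * f m z) -
            (\<Sum>(m, n)\<in>F. (a - a0) ^ m * (k - k0) ^ n * e m n z))) \<longlongrightarrow> 0) (finite_subsets_at_top UNIV))"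
  proof (intro exI[of _ r] exI[of _ "\<lambda>p q. e (p, q)"] conjI allI impI)
    show "e (p, q) \<in> H2_even" for p q using H2_boundedD(1)[OF e] .
    fix a k assume "\<bar>a - a0\<bar> < r \<and> \<bar>k - k0\<bar> < r"
    then have ak: "\<bar>a - a0\<bar> < r" "\<bar>k - k0\<bar> < r" by auto
    define \<xi> where "\<xi> i = (a - a0) ^ fst i * (k - k0) ^ snd i" for i :: "nat \<times> nat"
    define F where "F z = (\<Sum>\<^sub>\<infinity>m. a ^ m * k ^ s m * f m z)" for z
    have hs: "((\<lambda>i. \<xi> i * e i z) has_sum F z) UNIV" for z
      unfolding \<xi>_def e_def F_def by (rule w[OF ak fle])
    have bd: "H2_bounded (\<lambda>z. \<xi> i * e i z) (\<bar>\<xi> i\<bar> * E i)" for i by (rule H2_bounded_cmult[OF e])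
    have sm: "(\<lambda>i. \<bar>\<xi> i\<bar> * E i) summable_on UNIV"
    proof (rule summable_on_comparison_test[OF wR])
      fix i :: "nat \<times> nat"
      show "\<bar>\<xi> i\<bar> * E i \<le> (r ^ fst i * r ^ snd i) * (\<Sum>\<^sub>\<infinity>m. \<bar>w m i\<bar> * N m)"
        unfolding E_def[symmetric] \<xi>_def abs_mult power_abs using ak E0
        by (intro mult_right_mono mult_mono power_mono) auto
    qed (use E0 in auto)
    have "F \<in> H2_even" using H2_boundedD(1)[OF H2_bounded_infsum[OF bd sm hs]] .
    then show "(\<lambda>z. \<Sum>\<^sub>\<infinity>m. a ^ m * k ^ s m * f m z) \<in> H2_even" by (simp add: F_def[abs_def])
    define T where "T = (\<Sum>\<^sub>\<infinity>i. \<bar>\<xi> i\<bar> * E i)"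
    have T: "((\<lambda>i. \<bar>\<xi> i\<bar> * E i) has_sum T) UNIV" unfolding T_def using sm by (rule has_sum_infsum)
    have "((\<lambda>X. H2_norm (\<lambda>z. F z - (\<Sum>i\<in>X. \<xi> i * e i z))) \<longlongrightarrow> 0) (finite_subsets_at_top UNIV)"
    proof (rule tendsto_sandwich[OF _ _ tendsto_const])
      show "((\<lambda>X. T - (\<Sum>i\<in>X. \<bar>\<xi> i\<bar> * E i)) \<longlongrightarrow> 0) (finite_subsets_at_top UNIV)"
        using tendsto_diff[OF tendsto_const[of T] T[unfolded has_sum_def]] by simp
      show "\<forall>\<^sub>F X in finite_subsets_at_top UNIV. H2_norm (\<lambda>z. F z - (\<Sum>i\<in>X. \<xi> i * e i z)) \<le> T - (\<Sum>i\<in>X. \<bar>\<xi> i\<bar> * E i)"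
      proof (rule eventually_finite_subsets_at_top_weakI)
        fix X :: "(nat \<times> nat) set" assume X: "finite X"
        have 1: "((\<lambda>i. \<xi> i * e i z) has_sum (F z - (\<Sum>i\<in>X. \<xi> i * e i z))) (UNIV - X)" for z
          by (rule has_sum_Diff[OF hs]) (use X in auto)
        have 2: "((\<lambda>i. \<bar>\<xi> i\<bar> * E i) has_sum (T - (\<Sum>i\<in>X. \<bar>\<xi> i\<bar> * E i))) (UNIV - X)"
          by (rule has_sum_Diff[OF T]) (use X in auto)
        show "H2_norm (\<lambda>z. F z - (\<Sum>i\<in>X. \<xi> i * e i z)) \<le> T - (\<Sum>i\<in>X. \<bar>\<xi> i\<bar> * E i)"
          using H2_boundedD(2)[OF H2_bounded_infsum[OF bd has_sum_imp_summable[OF 2] 1]]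
          unfolding infsumI[OF 2] .
      qed
    qed (simp add: H2_norm_nonneg)
    then show "((\<lambda>X. H2_norm (\<lambda>z. (\<Sum>\<^sub>\<infinity>m. a ^ m * k ^ s m * f m z) -
            (\<Sum>(p, q)\<in>X. (a - a0) ^ p * (k - k0) ^ q * e (p, q) z))) \<longlongrightarrow> 0) (finite_subsets_at_top UNIV)"
      by (simp add: F_def \<xi>_def case_prod_unfold)
  qed (use r in \<open>simp_all\<close>)
qed

lemma real_analytic2_on_add:
  assumes "real_analytic2_on f U" "real_analytic2_on g U"
  shows "real_analytic2_on (\<lambda>a k. f a k + g a k) U"
  unfolding real_analytic2_on_def
proof safe
  fix a0 k0 assume U: "(a0, k0) \<in> U"
  obtain r1 e1 where 1: "r1 > 0" "\<And>a k. \<bar>a - a0\<bar> < r1 \<and> \<bar>k - k0\<bar> < r1 \<Longrightarrow> (a, k) \<in> U \<and>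
      ((\<lambda>(m, n). (a - a0) ^ m * (k - k0) ^ n * e1 m n) has_sum f a k) UNIV"
    using bspec[OF assms(1)[unfolded real_analytic2_on_def] U] by auto
  obtain r2 e2 where 2: "r2 > 0" "\<And>a k. \<bar>a - a0\<bar> < r2 \<and> \<bar>k - k0\<bar> < r2 \<Longrightarrow> (a, k) \<in> U \<and>
      ((\<lambda>(m, n). (a - a0) ^ m * (k - k0) ^ n * e2 m n) has_sum g a k) UNIV"
    using bspec[OF assms(2)[unfolded real_analytic2_on_def] U] by auto
  show "\<exists>r>0. \<exists>e. \<forall>a k. \<bar>a - a0\<bar> < r \<and> \<bar>k - k0\<bar> < r \<longrightarrow> (a, k) \<in> U \<and>
      ((\<lambda>(m, n). (a - a0) ^ m * (k - k0) ^ n * e m n) has_sum f a k + g a k) UNIV"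
  proof (intro exI[of _ "min r1 r2"] exI[of _ "\<lambda>m n. e1 m n + e2 m n"] conjI allI impI)
    fix a k assume *: "\<bar>a - a0\<bar> < min r1 r2 \<and> \<bar>k - k0\<bar> < min r1 r2"
    then show "(a, k) \<in> U" using 1(2) by simp
    show "((\<lambda>(m, n). (a - a0) ^ m * (k - k0) ^ n * (e1 m n + e2 m n)) has_sum f a k + g a k) UNIV"
      using has_sum_add[OF 1(2)[of a k, THEN conjunct2] 2(2)[of a k, THEN conjunct2]] *
      by (simp add: case_prod_unfold distrib_left)
  qed (use 1 2 in auto)
qed

text \<open>Geometric series in \<open>k - k0\<close>. It supplies the one term of the wave speed that is not a polynomial in \<open>k\<close>.\<close>

lemma real_analytic2_on_const_divide:
  "real_analytic2_on (\<lambda>a k. d / k) (wave_domain \<rho>)"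
  unfolding real_analytic2_on_def
proof safe
  fix a0 k0 assume dom: "(a0, k0) \<in> wave_domain \<rho>"
  obtain r where r: "r > 0" "r < k0" "(\<bar>a0\<bar> + r, k0 + r) \<in> wave_domain \<rho>"
    "\<forall>a k. \<bar>a - a0\<bar> < r \<and> \<bar>k - k0\<bar> < r \<longrightarrow> (a, k) \<in> wave_domain \<rho>"
    by (rule wave_domain_polydisc[OF dom]) (rule that)
  define e where "e m n = (if m = 0 then d / k0 * (- 1 / k0) ^ n else 0)" for m n :: nat
  show "\<exists>r>0. \<exists>e. \<forall>a k. \<bar>a - a0\<bar> < r \<and> \<bar>k - k0\<bar> < r \<longrightarrow> (a, k) \<in> wave_domain \<rho> \<and>
      ((\<lambda>(m, n). (a - a0) ^ m * (k - k0) ^ n * e m n) has_sum d / k) UNIV"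
  proof (intro exI[of _ r] exI[of _ e] conjI allI impI)
    fix a k assume *: "\<bar>a - a0\<bar> < r \<and> \<bar>k - k0\<bar> < r"
    then show "(a, k) \<in> wave_domain \<rho>" using r by auto
    define t where "t = (k - k0) * (- 1 / k0)"
    have t: "\<bar>t\<bar> < 1" using * r by (simp add: t_def)
    have k: "k = k0 * (1 - t)" using r by (simp add: t_def field_simps)
    have "((\<lambda>n. t ^ n) has_sum (1 / (1 - t))) UNIV"
      using t geometric_sums[of t] summable_geometric[of "\<bar>t\<bar>"]
      by (intro norm_summable_imp_has_sum) (auto simp: power_abs)
    from has_sum_cmult_right[OF this, of "d / k0"]
    have "((\<lambda>n. d / k0 * t ^ n) has_sum d / k) UNIV" using k by simp
    moreover have "d / k0 * t ^ n = (a - a0) ^ 0 * (k - k0) ^ n * e 0 n" for n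
    proof -
      have "t ^ n = ((k - k0) * (- 1 / k0)) ^ n" by (simp add: t_def)
      then show ?thesis by (simp only: power_mult_distrib) (simp add: e_def)
    qed
    ultimately have "((\<lambda>n. (a - a0) ^ 0 * (k - k0) ^ n * e 0 n) has_sum d / k) UNIV" by simp
    then have "(((\<lambda>(m, n). (a - a0) ^ m * (k - k0) ^ n * e m n) \<circ> Pair 0) has_sum d / k) UNIV"
      by (simp add: o_def)
    then have "((\<lambda>(m, n). (a - a0) ^ m * (k - k0) ^ n * e m n) has_sum d / k) (range (Pair 0))"
      by (subst has_sum_reindex) (auto simp: inj_on_def)
    then show "((\<lambda>(m, n). (a - a0) ^ m * (k - k0) ^ n * e m n) has_sum d / k) UNIV"
      by (rule has_sum_cong_neutral[THEN iffD1, rotated -1]) (auto simp: e_def)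
  qed (use r in auto)
qed

section \<open>The Stokes recursion\<close>

text \<open>Minus the coefficient of \<open>b\<^sup>m\<close> at frequency \<open>n\<close> in \<open>2 H H'' + H'\<^sup>2\<close>, where \<open>h j\<close> lists the Fourier
  coefficients of order \<open>j\<close>. Only orders below \<open>m\<close> enter; the congruence rule exposes this to the
  termination proof of the recursion.\<close>

definition quad :: "(nat \<Rightarrow> int \<Rightarrow> real) \<Rightarrow> nat \<Rightarrow> int \<Rightarrow> real" where
  "quad h m n = (\<Sum>j\<in>{1..<m}. \<Sum>l\<in>{- int m..int m}.
     (2 * (of_int (n - l))\<^sup>2 + of_int l * of_int (n - l)) * h j l * h (m - j) (n - l))"

lemma quad_cong [fundef_cong]:
  assumes "m = m'" "n = n'" "\<And>j l. j < m' \<Longrightarrow> h j l = h' j l"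
  shows "quad h m n = quad h' m' n'"
  unfolding quad_def assms(1,2) by (intro sum.cong refl) (auto simp: assms(3))

text \<open>Recursion on the order \<open>m\<close>. The factor \<open>2 * quad _ (Suc j) 1\<close> is \<open>\<mu>\<^sub>j\<close>: the equation of order \<open>j + 1\<close> at the
  resonant frequency 1 reads \<open>- \<mu>\<^sub>j / 2 + quad = 0\<close>. Setting the resonant coefficients of order above 1 to
  zero makes \<open>b\<close> the amplitude of the first harmonic.\<close>

function stokes :: "nat \<Rightarrow> int \<Rightarrow> real" where
  "stokes m n =
     (if m \<le> 1 then (if m = 1 \<and> \<bar>n\<bar> = 1 then 1 / 2 else 0)
      else if \<bar>n\<bar> = 1 then 0
      else ((of_int n)\<^sup>2 * (\<Sum>j\<in>{1..<m}. 2 * quad (\<lambda>i l. stokes i l) (Suc j) 1 * stokes (m - j) n)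
              - quad (\<lambda>i l. stokes i l) m n) / (1 - (of_int n)\<^sup>2))"
  by pat_completeness auto
termination by (relation "Wellfounded.measure fst") auto

declare stokes.simps [simp del]

definition speed_coeff :: "nat \<Rightarrow> real" where
  "speed_coeff j = (if j = 0 then 1 else 2 * quad stokes (Suc j) 1)"

lemma stokes_0 [simp]: "stokes 0 n = 0"
  by (simp add: stokes.simps)

lemma stokes_1: "stokes (Suc 0) n = (if \<bar>n\<bar> = 1 then 1 / 2 else 0)"
  by (simp add: stokes.simps)

lemma stokes_resonant: "m > 1 \<Longrightarrow> \<bar>n\<bar> = 1 \<Longrightarrow> stokes m n = 0"
  by (simp add: stokes.simps)

lemma stokes_rec:
  assumes "m > 1" "\<bar>n\<bar> \<noteq> 1"
  shows "stokes m n =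
     ((of_int n)\<^sup>2 * (\<Sum>j\<in>{1..<m}. speed_coeff j * stokes (m - j) n) - quad stokes m n) / (1 - (of_int n)\<^sup>2)"
  using assms by (subst stokes.simps) (simp add: speed_coeff_def)

lemma quad_reflect:
  assumes "\<And>j l. j < m \<Longrightarrow> h j (- l) = h j l"
  shows "quad h m (- n) = quad h m n"
proof -
  have "(\<Sum>l\<in>{- int m..int m}. (2 * (of_int (- n - l))\<^sup>2 + of_int l * of_int (- n - l)) * h j l * h (m - j) (- n - l))
      = (\<Sum>l\<in>{- int m..int m}. (2 * (of_int (n - l))\<^sup>2 + of_int l * of_int (n - l)) * h j l * h (m - j) (n - l))"
    if "j \<in> {1..<m}" for j
  proof (rule sum.reindex_bij_witness[of _ uminus uminus])
    fix l
    have 1: "h j (- l) = h j l" using assms[of j l] that by auto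
    have 2: "h (m - j) (n - (- l)) = h (m - j) (- n - l)" using assms[of "m - j" "- n - l"] that by (auto simp: algebra_simps)
    show "(2 * (of_int (n - - l))\<^sup>2 + of_int (- l) * of_int (n - - l)) * h j (- l) * h (m - j) (n - - l) =
         (2 * (real_of_int (- n - l))\<^sup>2 + of_int l * of_int (- n - l)) * h j l * h (m - j) (- n - l)"
      unfolding 1 2 by (simp add: power2_eq_square algebra_simps)
  qed auto
  then show ?thesis unfolding quad_def by (rule sum.cong[OF refl])
qed

lemma quad_zero:
  assumes "\<And>j l. j \<in> {1..<m} \<Longrightarrow> h j l * h (m - j) (n - l) = 0"
  shows "quad h m n = 0"
  unfolding quad_def using assms by (intro sum.neutral ballI) (simp add: mult.assoc)

lemma stokes_reflect: "stokes m (- n) = stokes m n"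
proof (induction m arbitrary: n rule: less_induct)
  case (less m)
  consider "m = 0" | "m = 1" | "m > 1" "\<bar>n\<bar> = 1" | "m > 1" "\<bar>n\<bar> \<noteq> 1" by linarith
  then show ?case
  proof cases
    case 4
    have "quad stokes m (- n) = quad stokes m n" using less by (intro quad_reflect) auto
    moreover have "(\<Sum>j\<in>{1..<m}. speed_coeff j * stokes (m - j) (- n)) = (\<Sum>j\<in>{1..<m}. speed_coeff j * stokes (m - j) n)"
      using less by (intro sum.cong refl) auto
    ultimately show ?thesis using 4 by (simp add: stokes_rec)
  qed (auto simp: stokes_1 stokes_resonant)
qed

lemma stokes_support: "\<bar>n\<bar> > int m \<Longrightarrow> stokes m n = 0"
proof (induction m arbitrary: n rule: less_induct)
  case (less m)
  consider "m = 0" | "m = 1" | "m > 1" by linarith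
  then show ?case
  proof cases
    case 3
    have "quad stokes m n = 0"
    proof (rule quad_zero)
      fix j l assume j: "j \<in> {1..<m}"
      show "stokes j l * stokes (m - j) (n - l) = 0"
      proof (cases "\<bar>l\<bar> > int j")
        case True then show ?thesis using less j by auto
      next
        case False
        then have "\<bar>n - l\<bar> > int (m - j)" using less.prems j by (auto simp: of_nat_diff)
        then show ?thesis using less.IH[of "m - j" "n - l"] j by auto
      qed
    qed
    moreover have "(\<Sum>j\<in>{1..<m}. speed_coeff j * stokes (m - j) n) = 0"
      using less by (intro sum.neutral ballI) (auto simp: of_nat_diff)
    ultimately show ?thesis using 3 less.prems by (simp add: stokes_rec)
  qed (use less in \<open>auto simp: stokes_1\<close>)
qed

lemma parity_zero_sum:
  assumes "odd (int m + n)" "j \<le> m"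
  shows "odd (int j + l) \<or> odd (int (m - j) + (n - l))"
  using assms by (auto simp: of_nat_diff)

text \<open>A product of frequencies \<open>l\<close> and \<open>n - l\<close> in orders \<open>j\<close> and \<open>m - j\<close> preserves the parity of order plus
  frequency. For odd \<open>j\<close> the resonant equation of order \<open>j + 1\<close> is of the wrong parity, so \<open>\<mu>\<^sub>j = 0\<close>. This
  expresses that a shift of the wave by half a period changes the sign of its amplitude.\<close>

lemma stokes_parity: "odd (int m + n) \<Longrightarrow> stokes m n = 0"
  and speed_coeff_odd: "odd j \<Longrightarrow> speed_coeff j = 0"
proof -
  have Q: "quad stokes m n = 0"
    if "odd (int m + n)" and IH: "\<And>i n. i < m \<Longrightarrow> odd (int i + n) \<Longrightarrow> stokes i n = 0" for m n
  proof (rule quad_zero)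
    fix j l assume j: "j \<in> {1..<m}"
    have "odd (int j + l) \<or> odd (int (m - j) + (n - l))" using that(1) j by (intro parity_zero_sum) auto
    moreover have "odd (int j + l) \<Longrightarrow> stokes j l = 0" using IH[of j l] j by simp
    moreover have "odd (int (m - j) + (n - l)) \<Longrightarrow> stokes (m - j) (n - l) = 0"
      using IH[of "m - j" "n - l"] j by simp
    ultimately show "stokes j l * stokes (m - j) (n - l) = 0" by auto
  qed
  have S: "odd (int m + n) \<Longrightarrow> stokes m n = 0" for m n
  proof (induction m arbitrary: n rule: less_induct)
    case (less m)
    consider "m = 0" | "m = 1" | "m > 1" "\<bar>n\<bar> = 1" | "m > 1" "\<bar>n\<bar> \<noteq> 1" by linarith
    then show ?case
    proof cases
      case 2 then show ?thesis using less.prems by (auto simp: stokes_1 abs_if split: if_splits)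
    next
      case 4
      have "(\<Sum>j\<in>{1..<m}. speed_coeff j * stokes (m - j) n) = 0"
      proof (intro sum.neutral ballI)
        fix j assume j: "j \<in> {1..<m}"
        show "speed_coeff j * stokes (m - j) n = 0"
        proof (cases "even j")
          case True
          then have "odd (int (m - j) + n)" using less.prems j by (auto simp: of_nat_diff)
          then show ?thesis using less.IH[of "m - j" n] j by auto
        next
          case False
          then have "quad stokes (Suc j) 1 = 0" using less.IH j by (intro Q) auto
          then show ?thesis using j by (simp add: speed_coeff_def)
        qed
      qed
      then show ?thesis using 4 less Q by (simp add: stokes_rec)
    qed (auto simp: stokes_resonant)
  qed
  show "odd (int m + n) \<Longrightarrow> stokes m n = 0" by (rule S)
  show "odd j \<Longrightarrow> speed_coeff j = 0" using Q[of "Suc j" 1] S by (cases "j = 0") (auto simp: speed_coeff_def)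
qed

lemma atLeastAtMost_int_rec:
  fixes a b :: int
  assumes "a \<le> b" shows "{a..b} = insert a {a+1..b}"
  using assms by auto

lemma stokes_2: "stokes 2 n = (if n = 0 then - 1/2 else if \<bar>n\<bar> = 2 then 1/4 else 0)"
proof -
  have Q0: "quad stokes 2 0 = 1/2" and Q1: "quad stokes 2 1 = 0" and Q2: "quad stokes 2 2 = 3/4"
    unfolding quad_def by (simp_all add: atLeastAtMost_int_rec stokes_1 numeral_2_eq_2 atLeastLessThanSuc)
  have s1: "speed_coeff 1 = 0" by (rule speed_coeff_odd) auto
  have 0: "stokes 2 0 = - 1/2" using stokes_rec[of 2 0] Q0 by simp
  have 2: "stokes 2 2 = 1/4"
    using stokes_rec[of 2 2] Q2 by (simp add: numeral_2_eq_2 atLeastLessThanSuc stokes_1)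
  have "stokes 2 (-2) = 1/4" using 2 stokes_reflect[of 2 2] by simp
  moreover have "stokes 2 n = 0" if "\<bar>n\<bar> > 2" using stokes_support[of 2 n] that by simp
  moreover have "stokes 2 n = 0" if "\<bar>n\<bar> = 1" using stokes_resonant[of 2 n] that by simp
  moreover have "\<bar>n\<bar> > 2 \<or> \<bar>n\<bar> = 1 \<or> n = 0 \<or> n = 2 \<or> n = -2" by linarith
  ultimately show ?thesis using 0 2 by auto
qed

lemma speed_coeff_2: "speed_coeff 2 = 1 / 2"
  unfolding speed_coeff_def quad_def
  by (simp add: atLeastAtMost_int_rec stokes_1 stokes_2[unfolded numeral_2_eq_2] eval_nat_numeral atLeastLessThanSuc)

lemma stokes_3: "stokes 3 n = (if \<bar>n\<bar> = 3 then 7/32 else 0)"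
proof -
  have Q3: "quad stokes 3 3 = 7/4"
    unfolding quad_def by (simp add: atLeastAtMost_int_rec stokes_1 stokes_2[unfolded numeral_2_eq_2] eval_nat_numeral atLeastLessThanSuc)
  have 3: "stokes 3 3 = 7/32"
    using stokes_rec[of 3 3] Q3
    by (simp add: eval_nat_numeral atLeastLessThanSuc stokes_1 stokes_2[unfolded numeral_2_eq_2])
  have "stokes 3 (-3) = 7/32" using 3 stokes_reflect[of 3 3] by simp
  moreover have "stokes 3 n = 0" if "\<bar>n\<bar> > 3" using stokes_support[of 3 n] that by simp
  moreover have "stokes 3 n = 0" if "\<bar>n\<bar> = 1" using stokes_resonant[of 3 n] that by simp
  moreover have "stokes 3 n = 0" if "even n" using stokes_parity[of 3 n] that by simp
  moreover have "\<bar>n\<bar> > 3 \<or> \<bar>n\<bar> = 1 \<or> even n \<or> n = 3 \<or> n = -3" by presburger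
  moreover have "odd n \<or> \<bar>n\<bar> \<noteq> 3" by presburger
  ultimately show ?thesis using 3 by auto
qed

section \<open>Geometric growth of the Stokes coefficients\<close>

definition stokes_norm :: "nat \<Rightarrow> real" where
  "stokes_norm m = (\<Sum>n\<in>{- int m..int m}. (1 + (of_int n)\<^sup>2) * \<bar>stokes m n\<bar>)"

lemma stokes_norm_nonneg: "stokes_norm m \<ge> 0"
  unfolding stokes_norm_def by (intro sum_nonneg) auto

lemma sum_shift_le:
  fixes f :: "int \<Rightarrow> real"
  assumes "finite A" "finite K" "\<And>n. f n \<ge> 0" "\<And>n. n \<notin> K \<Longrightarrow> f n = 0"
  shows "(\<Sum>n\<in>A. f (n - l)) \<le> sum f K"
proof -
  have "(\<Sum>n\<in>A. f (n - l)) = sum f ((\<lambda>n. n - l) ` A)"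
    by (subst sum.reindex) (auto simp: inj_on_def)
  also have "\<dots> = sum f ((\<lambda>n. n - l) ` A \<inter> K)"
    using assms by (intro sum.mono_neutral_right) auto
  also have "\<dots> \<le> sum f K" using assms by (intro sum_mono2) auto
  finally show ?thesis .
qed

lemma stokes_norm_shift:
  assumes "finite A"
  shows "(\<Sum>n\<in>A. (1 + (of_int (n - l))\<^sup>2) * \<bar>stokes m (n - l)\<bar>) \<le> stokes_norm m"
  unfolding stokes_norm_def
  by (rule sum_shift_le[of A _ "\<lambda>n. (1 + (of_int n)\<^sup>2) * \<bar>stokes m n\<bar>"])
     (use assms in \<open>auto simp: stokes_support\<close>)

lemma quad_kernel_le:
  fixes x y :: real
  shows "\<bar>2 * y\<^sup>2 + x * y\<bar> \<le> 3 * ((1 + x\<^sup>2) * (1 + y\<^sup>2))"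
proof -
  have "2 * \<bar>x * y\<bar> \<le> x\<^sup>2 + y\<^sup>2"
    using sum_squares_bound[of "\<bar>x\<bar>" "\<bar>y\<bar>"] by (simp add: abs_mult)
  moreover have "(1 + x\<^sup>2) * (1 + y\<^sup>2) = 1 + x\<^sup>2 + y\<^sup>2 + x\<^sup>2 * y\<^sup>2" by algebra
  moreover have "x\<^sup>2 * y\<^sup>2 \<ge> 0" "x\<^sup>2 \<ge> 0" "y\<^sup>2 \<ge> 0" by auto
  ultimately show ?thesis by (intro abs_leI) linarith+
qed

text \<open>The kernel of the quadratic term is bounded by the product of the two weights, so the weighted absolute
  sums multiply as in a convolution algebra.\<close>

lemma sum_abs_quad_le:
  assumes "finite A"
  shows "(\<Sum>n\<in>A. \<bar>quad stokes m n\<bar>) \<le> 3 * (\<Sum>j\<in>{1..<m}. stokes_norm j * stokes_norm (m - j))"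
proof -
  define w where "w j n = (1 + (of_int n)\<^sup>2) * \<bar>stokes j n\<bar>" for j n
  define L where "L = {- int m..int m}"
  have w0: "w j n \<ge> 0" for j n by (auto simp: w_def)
  have "\<bar>quad stokes m n\<bar> \<le> (\<Sum>j\<in>{1..<m}. \<Sum>l\<in>L. 3 * (w j l * w (m - j) (n - l)))" for n
    unfolding quad_def L_def[symmetric]
  proof (rule order.trans[OF sum_abs], rule sum_mono, rule order.trans[OF sum_abs], rule sum_mono)
    fix j l
    have "\<bar>(2 * (real_of_int (n - l))\<^sup>2 + of_int l * of_int (n - l)) * stokes j l * stokes (m - j) (n - l)\<bar>
        = \<bar>2 * (real_of_int (n - l))\<^sup>2 + of_int l * of_int (n - l)\<bar> * (\<bar>stokes j l\<bar> * \<bar>stokes (m - j) (n - l)\<bar>)"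
      by (simp add: abs_mult)
    also have "\<dots> \<le> 3 * ((1 + (of_int l)\<^sup>2) * (1 + (of_int (n - l))\<^sup>2)) * (\<bar>stokes j l\<bar> * \<bar>stokes (m - j) (n - l)\<bar>)"
      by (intro mult_right_mono quad_kernel_le) auto
    finally show "\<bar>(2 * (real_of_int (n - l))\<^sup>2 + of_int l * of_int (n - l)) * stokes j l * stokes (m - j) (n - l)\<bar>
        \<le> 3 * (w j l * w (m - j) (n - l))" unfolding w_def by (simp only: mult_ac)
  qed
  then have "(\<Sum>n\<in>A. \<bar>quad stokes m n\<bar>) \<le> (\<Sum>n\<in>A. \<Sum>j\<in>{1..<m}. \<Sum>l\<in>L. 3 * (w j l * w (m - j) (n - l)))"
    by (rule sum_mono)
  also have "\<dots> = (\<Sum>j\<in>{1..<m}. \<Sum>n\<in>A. \<Sum>l\<in>L. 3 * (w j l * w (m - j) (n - l)))" by (rule sum.swap)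
  also have "\<dots> = (\<Sum>j\<in>{1..<m}. \<Sum>l\<in>L. \<Sum>n\<in>A. 3 * (w j l * w (m - j) (n - l)))"
    by (intro sum.cong refl sum.swap)
  also have "\<dots> = 3 * (\<Sum>j\<in>{1..<m}. \<Sum>l\<in>L. w j l * (\<Sum>n\<in>A. w (m - j) (n - l)))"
    by (simp add: sum_distrib_left)
  also have "\<dots> \<le> 3 * (\<Sum>j\<in>{1..<m}. \<Sum>l\<in>L. w j l * stokes_norm (m - j))"
    using stokes_norm_shift[OF assms] w0 by (intro mult_left_mono sum_mono) (auto simp: w_def)
  also have "\<dots> = 3 * (\<Sum>j\<in>{1..<m}. (\<Sum>l\<in>L. w j l) * stokes_norm (m - j))"
    by (simp add: sum_distrib_right)
  also have "\<dots> \<le> 3 * (\<Sum>j\<in>{1..<m}. stokes_norm j * stokes_norm (m - j))"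
    using stokes_norm_shift[of L 0] stokes_norm_nonneg
    by (intro mult_left_mono sum_mono mult_right_mono) (auto simp: w_def L_def)
  finally show ?thesis .
qed

lemma abs_speed_coeff_le:
  assumes "j \<ge> 1"
  shows "\<bar>speed_coeff j\<bar> \<le> 6 * (\<Sum>i\<in>{1..<Suc j}. stokes_norm i * stokes_norm (Suc j - i))"
  using sum_abs_quad_le[of "{1}" "Suc j"] assms by (simp add: speed_coeff_def abs_mult)

text \<open>Away from resonance \<open>1 + n\<^sup>2 \<le> 2 \<bar>1 - n\<^sup>2\<bar>\<close>, so dividing by \<open>1 - n\<^sup>2\<close> pays for the weight \<open>1 + n\<^sup>2\<close>. There is
  no loss of derivatives, and the estimate closes.\<close>

lemma stokes_norm_rec_le:
  assumes "m \<ge> 2"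
  shows "stokes_norm m \<le> 2 * ((\<Sum>j\<in>{1..<m}. \<bar>speed_coeff j\<bar> * stokes_norm (m - j))
           + 3 * (\<Sum>j\<in>{1..<m}. stokes_norm j * stokes_norm (m - j)))"
proof -
  define w where "w j n = (1 + (of_int n)\<^sup>2) * \<bar>stokes j n\<bar>" for j n
  define L where "L = {- int m..int m}"
  have w0: "w j n \<ge> 0" for j n by (auto simp: w_def)
  \<comment> \<open>frequency by frequency; \<open>n = \<plusminus>1\<close> is trivial because the resonant coefficients vanish\<close>
  have le: "w m n \<le> 2 * ((\<Sum>j\<in>{1..<m}. \<bar>speed_coeff j\<bar> * w (m - j) n) + \<bar>quad stokes m n\<bar>)" for n
  proof (cases "\<bar>n\<bar> = 1")
    case True
    then have "w m n = 0" using assms by (simp add: w_def stokes_resonant)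
    then show ?thesis using w0 by (simp add: add_nonneg_nonneg sum_nonneg)
  next
    case False
    define x :: real where "x = (of_int n)\<^sup>2"
    have "x = 0 \<or> x \<ge> 4"
    proof (cases "n = 0")
      case False
      then have "\<bar>n\<bar> \<ge> 2" using \<open>\<bar>n\<bar> \<noteq> 1\<close> by linarith
      then have "(2::real)\<^sup>2 \<le> \<bar>of_int n\<bar>\<^sup>2" by (intro power_mono) linarith+
      then show ?thesis by (simp add: x_def)
    qed (simp add: x_def)
    then have x: "x \<ge> 0" "1 - x \<noteq> 0" "1 + x \<le> 2 * \<bar>1 - x\<bar>" by auto
    define R where "R = x * (\<Sum>j\<in>{1..<m}. speed_coeff j * stokes (m - j) n) - quad stokes m n"
    have "stokes m n = R / (1 - x)" using stokes_rec[of m n] False assms by (simp add: x_def R_def)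
    then have "\<bar>stokes m n\<bar> * \<bar>1 - x\<bar> = \<bar>R\<bar>" using x by (simp add: abs_divide)
    then have "w m n \<le> 2 * \<bar>R\<bar>"
      using mult_right_mono[OF x(3), of "\<bar>stokes m n\<bar>"] by (simp add: w_def x_def algebra_simps)
    also have "\<bar>R\<bar> \<le> x * (\<Sum>j\<in>{1..<m}. \<bar>speed_coeff j\<bar> * \<bar>stokes (m - j) n\<bar>) + \<bar>quad stokes m n\<bar>"
    proof -
      have "\<bar>x * (\<Sum>j\<in>{1..<m}. speed_coeff j * stokes (m - j) n)\<bar> \<le> x * (\<Sum>j\<in>{1..<m}. \<bar>speed_coeff j\<bar> * \<bar>stokes (m - j) n\<bar>)"
        unfolding abs_mult abs_of_nonneg[OF x(1)] using x(1)
        by (intro mult_left_mono order.trans[OF sum_abs] sum_mono) (auto simp: abs_mult)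
      then show ?thesis unfolding R_def by linarith
    qed
    also have "x * (\<Sum>j\<in>{1..<m}. \<bar>speed_coeff j\<bar> * \<bar>stokes (m - j) n\<bar>) \<le> (\<Sum>j\<in>{1..<m}. \<bar>speed_coeff j\<bar> * w (m - j) n)"
      unfolding sum_distrib_left
    proof (rule sum_mono)
      fix j
      have "x * (\<bar>speed_coeff j\<bar> * \<bar>stokes (m - j) n\<bar>) = \<bar>speed_coeff j\<bar> * (x * \<bar>stokes (m - j) n\<bar>)" by simp
      also have "\<dots> \<le> \<bar>speed_coeff j\<bar> * w (m - j) n"
        unfolding w_def x_def by (intro mult_left_mono mult_right_mono) auto
      finally show "x * (\<bar>speed_coeff j\<bar> * \<bar>stokes (m - j) n\<bar>) \<le> \<bar>speed_coeff j\<bar> * w (m - j) n" .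
    qed
    finally show ?thesis by simp
  qed
  have "stokes_norm m = (\<Sum>n\<in>L. w m n)" by (simp add: stokes_norm_def w_def L_def)
  also have "\<dots> \<le> (\<Sum>n\<in>L. 2 * ((\<Sum>j\<in>{1..<m}. \<bar>speed_coeff j\<bar> * w (m - j) n) + \<bar>quad stokes m n\<bar>))"
    by (intro sum_mono le)
  also have "\<dots> = 2 * ((\<Sum>n\<in>L. \<Sum>j\<in>{1..<m}. \<bar>speed_coeff j\<bar> * w (m - j) n) + (\<Sum>n\<in>L. \<bar>quad stokes m n\<bar>))"
    by (simp add: sum_distrib_left sum.distrib)
  also have "(\<Sum>n\<in>L. \<Sum>j\<in>{1..<m}. \<bar>speed_coeff j\<bar> * w (m - j) n) = (\<Sum>j\<in>{1..<m}. \<bar>speed_coeff j\<bar> * (\<Sum>n\<in>L. w (m - j) n))"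
    by (subst sum.swap) (simp add: sum_distrib_left)
  also have "\<dots> \<le> (\<Sum>j\<in>{1..<m}. \<bar>speed_coeff j\<bar> * stokes_norm (m - j))"
    using stokes_norm_shift[of L 0] by (intro sum_mono mult_left_mono) (auto simp: w_def L_def)
  also have "(\<Sum>n\<in>L. \<bar>quad stokes m n\<bar>) \<le> 3 * (\<Sum>j\<in>{1..<m}. stokes_norm j * stokes_norm (m - j))"
    by (intro sum_abs_quad_le) (simp add: L_def)
  finally show ?thesis by simp
qed

lemma sum_inverse_squares_le: "(\<Sum>j\<in>{1..<m}. 1 / (real j)\<^sup>2) \<le> 2"
proof -
  have "(\<Sum>j\<in>{1..<Suc n}. 1 / (real j)\<^sup>2) \<le> 2 - 1 / real n" if "n \<ge> 1" for n
    using that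
  proof (induction n rule: dec_induct)
    case (step n)
    have "1 / (real (Suc n))\<^sup>2 \<le> 1 / (real n * real (Suc n))"
      using step.hyps by (intro divide_left_mono) (auto simp: power2_eq_square)
    also have "\<dots> = 1 / real n - 1 / real (Suc n)" using step.hyps by (simp add: field_simps)
    finally show ?case using step.IH step.hyps by simp
  qed auto
  moreover have "m = 0 \<or> m = 1 \<or> (\<exists>n\<ge>1. m = Suc n)" by presburger
  ultimately show ?thesis by (fastforce intro: order.trans)
qed

text \<open>For \<open>i + j = m\<close>, \<open>1/(i\<^sup>2 j\<^sup>2) \<le> (2/m\<^sup>2) (1/i\<^sup>2 + 1/j\<^sup>2)\<close>, since \<open>(i + j)\<^sup>2 \<le> 2 (i\<^sup>2 + j\<^sup>2)\<close>.\<close>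

lemma sum_inverse_squares_convolution_le:
  "(\<Sum>j\<in>{1..<m}. 1 / (real j)\<^sup>2 * (1 / (real (m - j))\<^sup>2)) \<le> 8 / (real m)\<^sup>2"
proof -
  have "(\<Sum>j\<in>{1..<m}. 1 / (real j)\<^sup>2 * (1 / (real (m - j))\<^sup>2))
     \<le> (\<Sum>j\<in>{1..<m}. 2 / (real m)\<^sup>2 * (1 / (real j)\<^sup>2 + 1 / (real (m - j))\<^sup>2))"
  proof (rule sum_mono)
    fix j assume j: "j \<in> {1..<m}"
    define x y where "x = real j" and "y = real (m - j)"
    have xy: "x > 0" "y > 0" "real m = x + y" using j by (auto simp: x_def y_def of_nat_diff)
    have "(x + y)\<^sup>2 \<le> 2 * (x\<^sup>2 + y\<^sup>2)" using sum_squares_bound[of x y] by (simp add: power2_sum)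
    then show "1 / (real j)\<^sup>2 * (1 / (real (m - j))\<^sup>2) \<le> 2 / (real m)\<^sup>2 * (1 / (real j)\<^sup>2 + 1 / (real (m - j))\<^sup>2)"
      unfolding x_def[symmetric] y_def[symmetric] xy(3) using xy
      by (simp add: field_simps add_pos_pos)
  qed
  also have "\<dots> = 2 / (real m)\<^sup>2 * ((\<Sum>j\<in>{1..<m}. 1 / (real j)\<^sup>2) + (\<Sum>j\<in>{1..<m}. 1 / (real (m - j))\<^sup>2))"
    by (simp only: sum_distrib_left[symmetric] sum.distrib)
  also have "(\<Sum>j\<in>{1..<m}. 1 / (real (m - j))\<^sup>2) = (\<Sum>j\<in>{1..<m}. 1 / (real j)\<^sup>2)"
    by (rule sum.reindex_bij_witness[of _ "\<lambda>j. m - j" "\<lambda>j. m - j"]) auto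
  also have "2 / (real m)\<^sup>2 * ((\<Sum>j\<in>{1..<m}. 1 / (real j)\<^sup>2) + (\<Sum>j\<in>{1..<m}. 1 / (real j)\<^sup>2)) \<le> 2 / (real m)\<^sup>2 * (2 + 2)"
    by (intro mult_left_mono add_mono sum_inverse_squares_le) auto
  finally show ?thesis by simp
qed

text \<open>The shape \<open>A K\<^bsup>j-1\<^esup> / j\<^sup>2\<close> is stable under convolution, with one factor \<open>K\<close> to spare: this factor absorbs
  all constants when \<open>K\<close> is large.\<close>

lemma convolution_majorant:
  fixes f g :: "nat \<Rightarrow> real"
  assumes "m \<ge> 2" "K > 0" "A \<ge> 0" "B \<ge> 0"
    and f: "\<And>j. j \<in> {1..<m} \<Longrightarrow> 0 \<le> f j \<and> f j \<le> A * K ^ (j - 1) / (real j)\<^sup>2"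
    and g: "\<And>j. j \<in> {1..<m} \<Longrightarrow> 0 \<le> g j \<and> g j \<le> B * K ^ (j - 1) / (real j)\<^sup>2"
  shows "(\<Sum>j\<in>{1..<m}. f j * g (m - j)) \<le> 8 * A * B * K ^ (m - 2) / (real m)\<^sup>2"
proof -
  have "(\<Sum>j\<in>{1..<m}. f j * g (m - j))
     \<le> (\<Sum>j\<in>{1..<m}. (A * B * K ^ (m - 2)) * (1 / (real j)\<^sup>2 * (1 / (real (m - j))\<^sup>2)))"
  proof (rule sum_mono)
    fix j assume j: "j \<in> {1..<m}"
    have "f j * g (m - j) \<le> (A * K ^ (j - 1) / (real j)\<^sup>2) * (B * K ^ (m - j - 1) / (real (m - j))\<^sup>2)"
      using f[of j] g[of "m - j"] j assms by (intro mult_mono) auto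
    also have "\<dots> = (A * B * (K ^ (j - 1) * K ^ (m - j - 1))) * (1 / (real j)\<^sup>2 * (1 / (real (m - j))\<^sup>2))"
      by (simp add: field_simps)
    also have "K ^ (j - 1) * K ^ (m - j - 1) = K ^ (m - 2)"
      using j by (simp add: power_add[symmetric])
    finally show "f j * g (m - j) \<le> (A * B * K ^ (m - 2)) * (1 / (real j)\<^sup>2 * (1 / (real (m - j))\<^sup>2))" .
  qed
  also have "\<dots> = A * B * K ^ (m - 2) * (\<Sum>j\<in>{1..<m}. 1 / (real j)\<^sup>2 * (1 / (real (m - j))\<^sup>2))"
    by (simp only: sum_distrib_left)
  also have "\<dots> \<le> A * B * K ^ (m - 2) * (8 / (real m)\<^sup>2)"
    using assms by (intro mult_left_mono sum_inverse_squares_convolution_le) auto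
  finally show ?thesis by (simp add: mult_ac)
qed

lemma speed_coeff_majorant:
  assumes "j \<ge> 1" "\<And>i. i \<in> {1..j} \<Longrightarrow> stokes_norm i \<le> 2 * 4000 ^ (i - 1) / (real i)\<^sup>2"
  shows "\<bar>speed_coeff j\<bar> \<le> 192 * 4000 ^ (j - 1) / (real j)\<^sup>2"
proof -
  have "(\<Sum>i\<in>{1..<Suc j}. stokes_norm i * stokes_norm (Suc j - i)) \<le> 8 * 2 * 2 * 4000 ^ (Suc j - 2) / (real (Suc j))\<^sup>2"
    using assms stokes_norm_nonneg by (intro convolution_majorant) auto
  also have "\<dots> \<le> 8 * 2 * 2 * 4000 ^ (Suc j - 2) / (real j)\<^sup>2"
    using assms(1) by (intro divide_left_mono power_mono) auto
  finally show ?thesis using abs_speed_coeff_le[OF assms(1)] by (simp add: numeral_2_eq_2)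
qed

text \<open>The two convolution bounds add up to \<open>6336 K\<^bsup>m-2\<^esup> / m\<^sup>2\<close> whatever \<open>K\<close> is, and the induction closes as soon as
  \<open>6336 \<le> 2 K\<close>; \<open>K = 4000\<close> is a round choice.\<close>

lemma stokes_norm_majorant: "m \<ge> 1 \<Longrightarrow> stokes_norm m \<le> 2 * 4000 ^ (m - 1) / (real m)\<^sup>2"
proof (induction m rule: less_induct)
  case (less m)
  show ?case
  proof (cases "m = 1")
    case True
    have "stokes_norm 1 = 2"
      unfolding stokes_norm_def by (simp add: atLeastAtMost_int_rec stokes_1)
    then show ?thesis using True by simp
  next
    case False
    then have m: "m \<ge> 2" using less.prems by simp
    have sc: "\<bar>speed_coeff j\<bar> \<le> 192 * 4000 ^ (j - 1) / (real j)\<^sup>2" if "j \<in> {1..<m}" for j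
      using that less.IH by (intro speed_coeff_majorant) auto
    have 1: "(\<Sum>j\<in>{1..<m}. \<bar>speed_coeff j\<bar> * stokes_norm (m - j)) \<le> 8 * 192 * 2 * 4000 ^ (m - 2) / (real m)\<^sup>2"
      using m less sc stokes_norm_nonneg by (intro convolution_majorant) auto
    have 2: "(\<Sum>j\<in>{1..<m}. stokes_norm j * stokes_norm (m - j)) \<le> 8 * 2 * 2 * 4000 ^ (m - 2) / (real m)\<^sup>2"
      using m less stokes_norm_nonneg by (intro convolution_majorant) auto
    have "stokes_norm m \<le> 2 * (8 * 192 * 2 * 4000 ^ (m - 2) / (real m)\<^sup>2 + 3 * (8 * 2 * 2 * 4000 ^ (m - 2) / (real m)\<^sup>2))"
      by (rule order.trans[OF stokes_norm_rec_le[OF m]]) (intro mult_left_mono add_mono 1 2; simp)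
    also have "\<dots> = 6336 * 4000 ^ (m - 2) / (real m)\<^sup>2" by simp
    also have "\<dots> \<le> 2 * (4000 * 4000 ^ (m - 2)) / (real m)\<^sup>2" by (intro divide_right_mono) auto
    also have "4000 * 4000 ^ (m - 2) = (4000::real) ^ (m - 1)" using m by (simp add: power_Suc[symmetric] del: power_Suc)
    finally show ?thesis .
  qed
qed

lemma stokes_norm_le: "stokes_norm m \<le> 4000 ^ m"
proof (cases "m = 0")
  case False
  then have "stokes_norm m \<le> 2 * 4000 ^ (m - 1) / (real m)\<^sup>2" by (intro stokes_norm_majorant) simp
  also have "\<dots> \<le> 2 * 4000 ^ (m - 1) / 1" using False by (intro divide_left_mono) auto
  also have "\<dots> \<le> 4000 ^ m" using False by (cases m) auto
  finally show ?thesis .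
qed (simp add: stokes_norm_def)

lemma speed_coeff_le:
  assumes "j \<ge> 1" shows "\<bar>speed_coeff j\<bar> \<le> 6/125 * 4000 ^ j"
proof -
  have "\<bar>speed_coeff j\<bar> \<le> 192 * 4000 ^ (j - 1) / (real j)\<^sup>2"
    using assms by (intro speed_coeff_majorant stokes_norm_majorant) auto
  also have "\<dots> \<le> 192 * 4000 ^ (j - 1) / 1" using assms by (intro divide_left_mono) auto
  also have "\<dots> = 6/125 * 4000 ^ j" using assms by (cases j) auto
  finally show ?thesis .
qed

section \<open>Convergence and the differential equation\<close>

text \<open>The \<open>p\<close>-th derivative of \<open>P\<^sub>m\<close>. The phase shift by \<open>p\<close> quarter periods gives one formula for all \<open>p\<close>, so
  that differentiation merely increases \<open>p\<close>.\<close>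

definition stokes_poly :: "nat \<Rightarrow> nat \<Rightarrow> real \<Rightarrow> real" where
  "stokes_poly p m z =
     (\<Sum>n\<in>{- int m..int m}. stokes m n * of_int n ^ p * cos (of_int n * z + real p * (pi / 2)))"

lemma cos_quarter_shift: "cos (x + pi / 2) = - sin x" for x :: real
  by (simp add: cos_add)

lemma stokes_poly_deriv:
  "(stokes_poly p m has_real_derivative stokes_poly (Suc p) m z) (at z)"
proof -
  have "cos (of_int n * z + real (Suc p) * (pi / 2)) = - sin (of_int n * z + real p * (pi / 2))" for n
    unfolding cos_quarter_shift[symmetric] by (simp add: algebra_simps add_divide_distrib)
  then show ?thesis unfolding stokes_poly_def
    by (auto intro!: derivative_eq_intros sum.cong simp del: of_nat_Suc)
qed

lemma abs_stokes_poly_le: "\<bar>stokes_poly p m z\<bar> \<le> real m ^ p * stokes_norm m"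
  unfolding stokes_poly_def stokes_norm_def sum_distrib_left
proof (rule order.trans[OF sum_abs], rule sum_mono)
  fix n assume n: "n \<in> {- int m..int m}"
  define c where "c = cos (of_int n * z + real p * (pi / 2))"
  have "\<bar>stokes m n * of_int n ^ p * c\<bar> = \<bar>of_int n\<bar> ^ p * (\<bar>stokes m n\<bar> * \<bar>c\<bar>)"
    by (simp add: abs_mult power_abs)
  also have "\<dots> \<le> real m ^ p * (\<bar>stokes m n\<bar> * 1)"
    using n by (intro mult_mono power_mono mult_left_mono) (auto simp: c_def)
  also have "\<dots> \<le> real m ^ p * ((1 + (of_int n)\<^sup>2) * \<bar>stokes m n\<bar>)"
    by (intro mult_left_mono) (auto simp: algebra_simps)
  finally show "\<bar>stokes m n * of_int n ^ p * c\<bar> \<le> real m ^ p * ((1 + (of_int n)\<^sup>2) * \<bar>stokes m n\<bar>)" .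
qed

lemma stokes_poly_0: "stokes_poly 0 m z = (\<Sum>n\<in>{- int m..int m}. stokes m n * cos (of_int n * z))"
  by (simp add: stokes_poly_def)

lemma stokes_poly_1: "stokes_poly 1 m z = - (\<Sum>n\<in>{- int m..int m}. stokes m n * of_int n * sin (of_int n * z))"
  by (simp add: stokes_poly_def cos_quarter_shift sum_negf)

lemma stokes_poly_2: "stokes_poly 2 m z = - (\<Sum>n\<in>{- int m..int m}. stokes m n * (of_int n)\<^sup>2 * cos (of_int n * z))"
  by (simp add: stokes_poly_def sum_negf)

lemma sum_odd_eq_0:
  fixes f :: "int \<Rightarrow> real"
  assumes "\<And>n. f (- n) = - f n"
  shows "(\<Sum>n\<in>{- k..k}. f n) = 0"
proof -
  have "(\<Sum>n\<in>{- k..k}. f n) = (\<Sum>n\<in>{- k..k}. f (- n))"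
    by (rule sum.reindex_bij_witness[of _ uminus uminus]) auto
  then show ?thesis by (simp add: assms sum_negf)
qed

text \<open>Expanding \<open>cos((l + l') z)\<close> splits each of the two terms into a product of cosine sums and a product of
  sine sums. One product of each pair vanishes, because the sums of \<open>stokes j l sin(l z)\<close> and of
  \<open>l stokes j l cos(l z)\<close> over a symmetric range are zero by oddness.\<close>

lemma stokes_poly_product:
  "2 * stokes_poly 0 j z * stokes_poly 2 k z + stokes_poly 1 j z * stokes_poly 1 k z
   = - (\<Sum>l\<in>{- int j..int j}. \<Sum>l'\<in>{- int k..int k}.
          (2 * (of_int l')\<^sup>2 + of_int l * of_int l') * stokes j l * stokes k l' * cos (of_int (l + l') * z))"
proof -
  define J K where "J = {- int j..int j}" and "K = {- int k..int k}"
  have s0: "(\<Sum>l\<in>J. stokes j l * sin (of_int l * z)) = 0"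
    unfolding J_def by (rule sum_odd_eq_0) (simp add: stokes_reflect)
  have s1: "(\<Sum>l\<in>J. stokes j l * of_int l * cos (of_int l * z)) = 0"
    unfolding J_def by (rule sum_odd_eq_0) (simp add: stokes_reflect)
  have "(\<Sum>l\<in>J. \<Sum>l'\<in>K. (2 * (of_int l')\<^sup>2 + of_int l * of_int l') * stokes j l * stokes k l' * cos (of_int (l + l') * z))
    = (\<Sum>l\<in>J. \<Sum>l'\<in>K. 2 * ((stokes j l * cos (of_int l * z)) * (stokes k l' * (of_int l')\<^sup>2 * cos (of_int l' * z)))
         - 2 * ((stokes j l * sin (of_int l * z)) * (stokes k l' * (of_int l')\<^sup>2 * sin (of_int l' * z)))
         + (stokes j l * of_int l * cos (of_int l * z)) * (stokes k l' * of_int l' * cos (of_int l' * z))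
         - (stokes j l * of_int l * sin (of_int l * z)) * (stokes k l' * of_int l' * sin (of_int l' * z)))"
    by (intro sum.cong refl) (simp add: distrib_right cos_add, algebra)
  also have "\<dots> = 2 * ((\<Sum>l\<in>J. stokes j l * cos (of_int l * z)) * (\<Sum>l'\<in>K. stokes k l' * (of_int l')\<^sup>2 * cos (of_int l' * z)))
         - 2 * ((\<Sum>l\<in>J. stokes j l * sin (of_int l * z)) * (\<Sum>l'\<in>K. stokes k l' * (of_int l')\<^sup>2 * sin (of_int l' * z)))
         + (\<Sum>l\<in>J. stokes j l * of_int l * cos (of_int l * z)) * (\<Sum>l'\<in>K. stokes k l' * of_int l' * cos (of_int l' * z))
         - (\<Sum>l\<in>J. stokes j l * of_int l * sin (of_int l * z)) * (\<Sum>l'\<in>K. stokes k l' * of_int l' * sin (of_int l' * z))"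
    by (simp only: sum.distrib sum_subtractf sum_product) (simp only: sum_distrib_left)
  finally show ?thesis
    unfolding s0 s1 stokes_poly_0 stokes_poly_1 stokes_poly_2 J_def[symmetric] K_def[symmetric] by simp
qed

lemma sum_int_convolution:
  fixes f :: "int \<Rightarrow> int \<Rightarrow> real"
  assumes "\<And>l l'. \<bar>l\<bar> > int j \<or> \<bar>l'\<bar> > int k \<Longrightarrow> f l l' = 0"
  shows "(\<Sum>l\<in>{- int j..int j}. \<Sum>l'\<in>{- int k..int k}. f l l' * g (l + l'))
       = (\<Sum>n\<in>{- int (j + k)..int (j + k)}. (\<Sum>l\<in>{- int (j + k)..int (j + k)}. f l (n - l)) * g n)"
proof -
  define L where "L = {- int (j + k)..int (j + k)}"
  have "(\<Sum>n\<in>L. (\<Sum>l\<in>L. f l (n - l)) * g n) = (\<Sum>l\<in>L. \<Sum>n\<in>L. f l (n - l) * g n)"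
    by (subst sum.swap) (simp add: sum_distrib_right)
  also have "\<dots> = (\<Sum>l\<in>{- int j..int j}. \<Sum>n\<in>L. f l (n - l) * g n)"
    by (rule sum.mono_neutral_right) (auto simp: L_def assms)
  also have "\<dots> = (\<Sum>l\<in>{- int j..int j}. \<Sum>l'\<in>{- int k..int k}. f l l' * g (l + l'))"
  proof (rule sum.cong[OF refl])
    fix l assume l: "l \<in> {- int j..int j}"
    have "(\<Sum>n\<in>L. f l (n - l) * g n) = (\<Sum>n\<in>{l - int k..l + int k}. f l (n - l) * g n)"
      using l by (intro sum.mono_neutral_right) (auto simp: L_def assms)
    also have "\<dots> = (\<Sum>l'\<in>{- int k..int k}. f l l' * g (l + l'))"
      by (rule sum.reindex_bij_witness[of _ "\<lambda>l'. l + l'" "\<lambda>n. n - l"]) auto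
    finally show "(\<Sum>n\<in>L. f l (n - l) * g n) = (\<Sum>l'\<in>{- int k..int k}. f l l' * g (l + l'))" .
  qed
  finally show ?thesis by (simp add: L_def)
qed

lemma stokes_poly_quad:
  "(\<Sum>j\<le>m. 2 * stokes_poly 0 j z * stokes_poly 2 (m - j) z + stokes_poly 1 j z * stokes_poly 1 (m - j) z)
   = - (\<Sum>n\<in>{- int m..int m}. quad stokes m n * cos (of_int n * z))"
proof -
  define F where "F j l l' = (2 * (of_int l')\<^sup>2 + of_int l * of_int l') * stokes j l * stokes (m - j) l'" for j and l l' :: int
  have "(\<Sum>j\<le>m. 2 * stokes_poly 0 j z * stokes_poly 2 (m - j) z + stokes_poly 1 j z * stokes_poly 1 (m - j) z)
      = (\<Sum>j\<le>m. - (\<Sum>n\<in>{- int m..int m}. (\<Sum>l\<in>{- int m..int m}. F j l (n - l)) * cos (of_int n * z)))"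
  proof (rule sum.cong[OF refl])
    fix j assume "j \<in> {..m}"
    then have m: "j + (m - j) = m" by simp
    have "(\<Sum>l\<in>{- int j..int j}. \<Sum>l'\<in>{- int (m - j)..int (m - j)}. F j l l' * cos (of_int (l + l') * z))
      = (\<Sum>n\<in>{- int m..int m}. (\<Sum>l\<in>{- int m..int m}. F j l (n - l)) * cos (of_int n * z))"
      by (rule sum_int_convolution[of j "m - j" "F j" "\<lambda>n. cos (of_int n * z)", unfolded m])
         (auto simp: F_def stokes_support simp del: of_nat_diff)
    then show "2 * stokes_poly 0 j z * stokes_poly 2 (m - j) z + stokes_poly 1 j z * stokes_poly 1 (m - j) z
      = - (\<Sum>n\<in>{- int m..int m}. (\<Sum>l\<in>{- int m..int m}. F j l (n - l)) * cos (of_int n * z))"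
      by (simp only: stokes_poly_product F_def)
  qed
  also have "\<dots> = - (\<Sum>n\<in>{- int m..int m}. (\<Sum>j\<le>m. \<Sum>l\<in>{- int m..int m}. F j l (n - l)) * cos (of_int n * z))"
    unfolding sum_negf sum_distrib_right by (subst sum.swap) (rule refl)
  also have "\<dots> = - (\<Sum>n\<in>{- int m..int m}. quad stokes m n * cos (of_int n * z))"
  proof -
    have "(\<Sum>j\<le>m. \<Sum>l\<in>{- int m..int m}. F j l (n - l)) = quad stokes m n" for n
      unfolding quad_def F_def by (intro sum.mono_neutral_right) (auto simp: Suc_le_eq)
    then show ?thesis by (simp only:)
  qed
  finally show ?thesis .
qed

text \<open>The equation of order \<open>m\<close> at frequency \<open>n\<close>. Off resonance it is the recursion; at \<open>n = \<plusminus>1\<close> only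
  \<open>j = m - 1\<close> survives in the sum, and the choice of \<open>\<mu>\<^bsub>m-1\<^esub>\<close> makes it cancel the quadratic term.\<close>

lemma stokes_coeff_identity:
  "(1 - (of_int n)\<^sup>2) * stokes m n - (of_int n)\<^sup>2 * (\<Sum>j\<in>{1..<m}. speed_coeff j * stokes (m - j) n) + quad stokes m n = 0"
proof -
  consider "m \<le> 1" | "m > 1" "\<bar>n\<bar> = 1" | "m > 1" "\<bar>n\<bar> \<noteq> 1" by linarith
  then show ?thesis
  proof cases
    case 1
    then have "m = 0 \<or> m = 1" by auto
    then show ?thesis by (auto simp: quad_def stokes_1 abs_if split: if_splits)
  next
    case 2
    have "(\<Sum>j\<in>{1..<m}. speed_coeff j * stokes (m - j) n) = (\<Sum>j\<in>{m - 1}. speed_coeff j * stokes (m - j) n)"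
      using 2 by (intro sum.mono_neutral_right) (auto intro!: stokes_resonant)
    also have "\<dots> = quad stokes m 1"
      using 2 by (simp add: stokes_1 speed_coeff_def)
    also have "\<dots> = quad stokes m n"
      using 2 quad_reflect[of m stokes 1] stokes_reflect by (auto simp: abs_if split: if_splits)
    moreover have "(real_of_int n)\<^sup>2 = 1"
      using 2 by (auto simp: abs_if split: if_splits)
    ultimately show ?thesis by simp
  next
    case 3
    have "(real_of_int n)\<^sup>2 \<noteq> 1" using 3(2) by (simp add: power2_eq_1_iff) linarith
    then show ?thesis using stokes_rec[OF 3] by (simp add: field_simps)
  qed
qed

lemma stokes_poly_equation:
  "(\<Sum>j\<le>m. speed_coeff j * stokes_poly 2 (m - j) z)
     - (\<Sum>j\<le>m. 2 * stokes_poly 0 j z * stokes_poly 2 (m - j) z + stokes_poly 1 j z * stokes_poly 1 (m - j) z)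
     + stokes_poly 0 m z = 0"
proof -
  define L where "L = {- int m..int m}"
  have "stokes_poly 2 (m - j) z = - (\<Sum>n\<in>L. stokes (m - j) n * (of_int n)\<^sup>2 * cos (of_int n * z))" for j
    unfolding stokes_poly_2 L_def
    by (intro arg_cong[of _ _ uminus] sum.mono_neutral_left) (auto simp: stokes_support)
  then have "(\<Sum>j\<le>m. speed_coeff j * stokes_poly 2 (m - j) z)
     = (\<Sum>j\<le>m. \<Sum>n\<in>L. - (speed_coeff j * (stokes (m - j) n * (of_int n)\<^sup>2 * cos (of_int n * z))))"
    by (simp add: sum_negf sum_distrib_left)
  also have "\<dots> = (\<Sum>n\<in>L. - ((of_int n)\<^sup>2 * (\<Sum>j\<le>m. speed_coeff j * stokes (m - j) n) * cos (of_int n * z)))"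
    by (subst sum.swap) (simp add: sum_negf sum_distrib_left sum_distrib_right mult_ac)
  also have "\<dots> = (\<Sum>n\<in>L. - ((of_int n)\<^sup>2 * (stokes m n + (\<Sum>j\<in>{1..<m}. speed_coeff j * stokes (m - j) n)) * cos (of_int n * z)))"
  proof -
    have "(\<Sum>j\<le>m. speed_coeff j * stokes (m - j) n) = stokes m n + (\<Sum>j\<in>{1..<m}. speed_coeff j * stokes (m - j) n)" for n
    proof (cases "m = 0")
      case False
      then have "{..m} = insert 0 (insert m {1..<m})" by auto
      then show ?thesis using False by (simp add: speed_coeff_def)
    qed simp
    then show ?thesis by simp
  qed
  finally have 1: "(\<Sum>j\<le>m. speed_coeff j * stokes_poly 2 (m - j) z) = \<dots>" .
  have "(\<Sum>j\<le>m. speed_coeff j * stokes_poly 2 (m - j) z)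
     - (\<Sum>j\<le>m. 2 * stokes_poly 0 j z * stokes_poly 2 (m - j) z + stokes_poly 1 j z * stokes_poly 1 (m - j) z)
     + stokes_poly 0 m z = (\<Sum>n\<in>L. ((1 - (of_int n)\<^sup>2) * stokes m n - (of_int n)\<^sup>2 * (\<Sum>j\<in>{1..<m}. speed_coeff j * stokes (m - j) n) + quad stokes m n) * cos (of_int n * z))"
    unfolding 1 stokes_poly_quad stokes_poly_0[of m z] L_def[symmetric]
    by (simp only: sum.distrib[symmetric] sum_subtractf[symmetric] sum_negf[symmetric]) (intro sum.cong refl, simp add: algebra_simps)
  then show ?thesis by (simp only: stokes_coeff_identity mult_zero_left sum.neutral_const)
qed

text \<open>The powers \<open>m\<^sup>p\<close> produced by \<open>p\<close> differentiations cost a factor \<open>3\<^sup>m\<close>, uniformly in \<open>p\<close> up to \<open>p!\<close>. Hence a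
  single radius of convergence in \<open>b\<close> serves all derivatives.\<close>

lemma power_le_fact_exp: "real m ^ p \<le> fact p * 3 ^ m"
proof -
  have "real m ^ p / fact p \<le> exp (real m)"
  proof -
    have "sum (\<lambda>n. real m ^ n /\<^sub>R fact n) {p} \<le> (\<Sum>n. real m ^ n /\<^sub>R fact n)"
      by (intro sum_le_suminf summable_exp_generic) auto
    then show ?thesis by (simp add: exp_def divide_inverse mult.commute)
  qed
  also have "exp (real m) = exp 1 ^ m" by (simp add: exp_of_nat_mult[symmetric])
  also have "\<dots> \<le> 3 ^ m" by (intro power_mono exp_le) auto
  finally show ?thesis by (simp add: field_simps)
qed

definition stokes_wave :: "nat \<Rightarrow> real \<Rightarrow> real \<Rightarrow> real" where
  "stokes_wave p b z = (\<Sum>m. b ^ m * stokes_poly p m z)"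

text \<open>The quantity \<open>\<mu> = 3 c\<^sup>2 k\<^sup>2\<close> of the scaled equation.\<close>

definition squared_speed :: "real \<Rightarrow> real" where
  "squared_speed b = (\<Sum>j. b ^ j * speed_coeff j)"

text \<open>The radius \<open>1/16000\<close> leaves room for the growth rate 4000 of the coefficients and the factor 3 per order
  for the derivatives.\<close>

lemma stokes_term_le:
  assumes "\<bar>b\<bar> \<le> 1/16000"
  shows "\<bar>b ^ m * stokes_poly p m z\<bar> \<le> fact p * (3/4) ^ m"
proof -
  have "\<bar>b ^ m * stokes_poly p m z\<bar> = \<bar>b\<bar> ^ m * \<bar>stokes_poly p m z\<bar>" by (simp add: abs_mult power_abs)
  also have "\<dots> \<le> (1/16000) ^ m * (real m ^ p * stokes_norm m)"
    using assms by (intro mult_mono power_mono abs_stokes_poly_le) auto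
  also have "\<dots> \<le> (1/16000) ^ m * ((fact p * 3 ^ m) * 4000 ^ m)"
    by (intro mult_left_mono mult_mono power_le_fact_exp stokes_norm_le stokes_norm_nonneg) auto
  also have "\<dots> = fact p * ((1/16000) * 3 * 4000) ^ m" by (simp only: power_mult_distrib mult_ac)
  finally show ?thesis by simp
qed

lemma summable_stokes_term:
  assumes "\<bar>b\<bar> \<le> 1/16000"
  shows "summable (\<lambda>m. norm (b ^ m * stokes_poly p m z))"
  by (rule summable_comparison_test'[of "\<lambda>m. fact p * (3/4) ^ m" 0])
     (use stokes_term_le[OF assms] in \<open>auto intro!: summable_mult summable_geometric\<close>)

lemma stokes_wave_deriv:
  assumes "\<bar>b\<bar> \<le> 1/16000"
  shows "(stokes_wave p b has_real_derivative stokes_wave (Suc p) b z) (at z)"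
proof -
  have "uniformly_convergent_on UNIV (\<lambda>n z. \<Sum>m<n. b ^ m * stokes_poly (Suc p) m z)"
    by (rule Weierstrass_m_test'[where M = "\<lambda>m. fact (Suc p) * (3/4) ^ m"])
       (use stokes_term_le[OF assms] in \<open>auto intro!: summable_mult summable_geometric simp del: fact_Suc\<close>)
  then have "((\<lambda>z. \<Sum>m. b ^ m * stokes_poly p m z) has_field_derivative (\<Sum>m. b ^ m * stokes_poly (Suc p) m z)) (at z)"
    using summable_norm_cancel[OF summable_stokes_term[OF assms]]
    by (intro has_field_derivative_series'(2)[where S = UNIV and x0 = z])
       (auto intro!: DERIV_cmult stokes_poly_deriv)
  then show ?thesis by (simp add: stokes_wave_def[abs_def])
qed

lemma speed_term_le: "j \<ge> 1 \<Longrightarrow> \<bar>b\<bar> \<le> 1/16000 \<Longrightarrow> \<bar>b ^ j * speed_coeff j\<bar> \<le> 6/125 * (1/4) ^ j"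
proof -
  assume a: "j \<ge> 1" "\<bar>b\<bar> \<le> 1/16000"
  have "\<bar>b ^ j * speed_coeff j\<bar> = \<bar>b\<bar> ^ j * \<bar>speed_coeff j\<bar>" by (simp add: abs_mult power_abs)
  also have "\<dots> \<le> (1/16000) ^ j * (6/125 * 4000 ^ j)" using a by (intro mult_mono power_mono speed_coeff_le) auto
  also have "\<dots> = 6/125 * ((1/16000) * 4000) ^ j" by (simp only: power_mult_distrib mult_ac)
  finally show ?thesis by simp
qed

lemma summable_speed_term:
  assumes "\<bar>b\<bar> \<le> 1/16000"
  shows "summable (\<lambda>j. norm (b ^ j * speed_coeff j))"
  by (rule summable_comparison_test'[of "\<lambda>j. 6/125 * (1/4) ^ j" 1])
     (use speed_term_le[OF _ assms] in \<open>auto intro!: summable_mult summable_geometric\<close>)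

text \<open>The Cauchy products of the three series have as their coefficients the left-hand sides of
  \<open>stokes_poly_equation\<close>, all of which vanish.\<close>

lemma stokes_wave_equation:
  assumes "\<bar>b\<bar> \<le> 1/16000"
  shows "(squared_speed b - 2 * stokes_wave 0 b z) * stokes_wave 2 b z - (stokes_wave 1 b z)\<^sup>2 + stokes_wave 0 b z = 0"
proof -
  define T where "T p m = b ^ m * stokes_poly p m z" for p m
  note S = summable_stokes_term[OF assms, of _ z, folded T_def]
  have W: "T p sums stokes_wave p b z" for p
    unfolding stokes_wave_def T_def[symmetric] using summable_norm_cancel[OF S] by (rule summable_sums)
  have "(\<lambda>m. (\<Sum>j\<le>m. b ^ j * speed_coeff j * T 2 (m - j)) - 2 * (\<Sum>j\<le>m. T 0 j * T 2 (m - j)) - (\<Sum>j\<le>m. T 1 j * T 1 (m - j)) + T 0 m)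
      sums (squared_speed b * stokes_wave 2 b z - 2 * (stokes_wave 0 b z * stokes_wave 2 b z) - stokes_wave 1 b z * stokes_wave 1 b z + stokes_wave 0 b z)"
    using Cauchy_product_sums[OF summable_speed_term[OF assms] S[of 2]]
      Cauchy_product_sums[OF S[of 0] S[of 2]] Cauchy_product_sums[OF S[of 1] S[of 1]] W
    unfolding squared_speed_def[symmetric] by (intro sums_add sums_diff sums_mult) (auto simp: sums_iff)
  also have "(\<lambda>m. (\<Sum>j\<le>m. b ^ j * speed_coeff j * T 2 (m - j)) - 2 * (\<Sum>j\<le>m. T 0 j * T 2 (m - j)) - (\<Sum>j\<le>m. T 1 j * T 1 (m - j)) + T 0 m) = (\<lambda>m. 0)"
  proof
    fix m
    have 1: "(\<Sum>j\<le>m. b ^ j * speed_coeff j * T 2 (m - j)) = b ^ m * (\<Sum>j\<le>m. speed_coeff j * stokes_poly 2 (m - j) z)"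
      unfolding sum_distrib_left T_def
      by (intro sum.cong refl) (simp add: power_add[symmetric] mult.assoc[symmetric])
    have 2: "(\<Sum>j\<le>m. T p j * T q (m - j)) = b ^ m * (\<Sum>j\<le>m. stokes_poly p j z * stokes_poly q (m - j) z)" for p q
      unfolding sum_distrib_left T_def
    proof (intro sum.cong refl)
      fix j assume "j \<in> {..m}"
      then have "b ^ m = b ^ j * b ^ (m - j)" by (simp add: power_add[symmetric])
      then show "b ^ j * stokes_poly p j z * (b ^ (m - j) * stokes_poly q (m - j) z) = b ^ m * (stokes_poly p j z * stokes_poly q (m - j) z)"
        by simp
    qed
    have "(\<Sum>j\<le>m. b ^ j * speed_coeff j * T 2 (m - j)) - 2 * (\<Sum>j\<le>m. T 0 j * T 2 (m - j)) - (\<Sum>j\<le>m. T 1 j * T 1 (m - j)) + T 0 m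
      = b ^ m * ((\<Sum>j\<le>m. speed_coeff j * stokes_poly 2 (m - j) z)
     - (\<Sum>j\<le>m. 2 * stokes_poly 0 j z * stokes_poly 2 (m - j) z + stokes_poly 1 j z * stokes_poly 1 (m - j) z)
     + stokes_poly 0 m z)"
      unfolding 1 2 sum.distrib by (simp add: T_def algebra_simps sum_distrib_left)
    then show "(\<Sum>j\<le>m. b ^ j * speed_coeff j * T 2 (m - j)) - 2 * (\<Sum>j\<le>m. T 0 j * T 2 (m - j)) - (\<Sum>j\<le>m. T 1 j * T 1 (m - j)) + T 0 m = 0"
      by (simp only: stokes_poly_equation mult_zero_right)
  qed
  finally show ?thesis using sums_unique2[OF _ sums_zero] by (fastforce simp: power2_eq_square algebra_simps)
qed

section \<open>Analyticity of the wave speed\<close>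

lemma suminf_speed_bound: "(\<Sum>j. 6/125 * (1/4) ^ Suc j) = (2/125 :: real)" "summable (\<lambda>j. 6/125 * (1/4::real) ^ Suc j)"
proof -
  have "(\<lambda>j. 6/125 * (1/4) * (1/4::real) ^ j) sums (6/125 * (1/4) * (1 / (1 - 1/4)))"
    by (intro sums_mult geometric_sums) auto
  then show "(\<Sum>j. 6/125 * (1/4) ^ Suc j) = (2/125 :: real)" "summable (\<lambda>j. 6/125 * (1/4::real) ^ Suc j)"
    by (auto simp: sums_iff)
qed

lemma complex_speed_series:
  assumes "norm z \<le> 1/16000"
  shows "summable (\<lambda>j. z ^ j * complex_of_real (speed_coeff j))"
    and "norm ((\<Sum>j. z ^ j * complex_of_real (speed_coeff j)) - 1) \<le> 2/125"
proof -
  have nz: "norm (z ^ j * complex_of_real (speed_coeff j)) = norm (norm z ^ j * speed_coeff j)" for j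
    by (simp add: norm_mult norm_power abs_mult)
  have S: "summable (\<lambda>j. norm (z ^ j * complex_of_real (speed_coeff j)))"
    unfolding nz using assms by (intro summable_speed_term) simp
  show S': "summable (\<lambda>j. z ^ j * complex_of_real (speed_coeff j))" by (rule summable_norm_cancel[OF S])
  have "(\<Sum>j. z ^ j * complex_of_real (speed_coeff j)) - 1 = (\<Sum>j. z ^ Suc j * complex_of_real (speed_coeff (Suc j)))"
    using suminf_split_head[OF S'] by (simp add: speed_coeff_def)
  also have "norm \<dots> \<le> (\<Sum>j. 6/125 * (1/4) ^ Suc j)"
  proof (rule norm_suminf_le[OF _ suminf_speed_bound(2)])
    fix j show "norm (z ^ Suc j * complex_of_real (speed_coeff (Suc j))) \<le> 6/125 * (1/4) ^ Suc j"
      unfolding nz using speed_term_le[of "Suc j" "norm z"] assms by simp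
  qed
  finally show "norm ((\<Sum>j. z ^ j * complex_of_real (speed_coeff j)) - 1) \<le> 2/125"
    by (simp only: suminf_speed_bound)
qed

lemma complex_speed_of_real:
  assumes "\<bar>b\<bar> \<le> 1/16000"
  shows "(\<Sum>j. complex_of_real b ^ j * complex_of_real (speed_coeff j)) = complex_of_real (squared_speed b)"
proof -
  have "(\<lambda>j. b ^ j * speed_coeff j) sums squared_speed b"
    unfolding squared_speed_def using summable_norm_cancel[OF summable_speed_term[OF assms]] by (rule summable_sums)
  from sums_of_real[OF this, where 'a = complex] show ?thesis by (simp add: sums_iff)
qed

lemma squared_speed_near_1:
  assumes "\<bar>b\<bar> \<le> 1/16000"
  shows "\<bar>squared_speed b - 1\<bar> \<le> 2/125"
proof -
  have "norm (complex_of_real (squared_speed b) - 1) \<le> 2/125"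
    using complex_speed_series(2)[of "complex_of_real b"] assms complex_speed_of_real[OF assms] by simp
  moreover have "complex_of_real (squared_speed b) - 1 = complex_of_real (squared_speed b - 1)" by simp
  ultimately show ?thesis by (simp only: norm_of_real)
qed

text \<open>For complex \<open>b\<close> the series \<open>\<mu>\<close> stays within \<open>2/125\<close> of 1, hence away from the branch cut of \<open>csqrt\<close>, and the
  holomorphic function \<open>csqrt (\<mu> / 3)\<close> has a power series on the disc. For real \<open>b\<close> the real parts of its
  coefficients suffice.\<close>

lemma sqrt_speed_power_series:
  "\<exists>C :: nat \<Rightarrow> real. \<forall>b. \<bar>b\<bar> < 1/16000 \<longrightarrow> (\<lambda>j. b ^ j * C j) sums sqrt (squared_speed b / 3)"
proof -
  define G where "G z = (\<Sum>j. z ^ j * complex_of_real (speed_coeff j))" for z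
  define H where "H z = csqrt (G z / 3)" for z
  let ?B = "ball (0::complex) (1/16000)"
  have "G holomorphic_on ?B"
  proof (rule power_series_holomorphic)
    fix w assume "w \<in> ?B"
    then have "summable (\<lambda>j. w ^ j * complex_of_real (speed_coeff j))"
      by (intro complex_speed_series) simp
    then show "(\<lambda>j. complex_of_real (speed_coeff j) * (w - 0) ^ j) sums G w"
      unfolding G_def by (simp add: summable_sums mult.commute)
  qed
  moreover have "G z / 3 \<notin> \<real>\<^sub>\<le>\<^sub>0" if "z \<in> ?B" for z
  proof -
    have "norm (G z - 1) \<le> 2/125" using that complex_speed_series(2)[of z] by (simp add: G_def)
    then have "\<bar>Re (G z - 1)\<bar> \<le> 2/125" using abs_Re_le_cmod[of "G z - 1"] by linarith
    then show ?thesis by (auto simp: complex_nonpos_Reals_iff)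
  qed
  ultimately have H: "H holomorphic_on ?B"
    unfolding H_def by (intro holomorphic_intros) auto
  define C where "C j = Re ((deriv ^^ j) H 0 / fact j)" for j
  show ?thesis
  proof (intro exI[of _ C] allI impI)
    fix b :: real assume b: "\<bar>b\<bar> < 1/16000"
    have "(\<lambda>j. (deriv ^^ j) H 0 / fact j * (complex_of_real b - 0) ^ j) sums H (complex_of_real b)"
      by (rule holomorphic_power_series[OF H]) (use b in simp)
    moreover have "Re ((deriv ^^ j) H 0 / fact j * (complex_of_real b - 0) ^ j) = b ^ j * C j" for j
    proof -
      have "(complex_of_real b - 0) ^ j = complex_of_real (b ^ j)" by simp
      then show ?thesis unfolding C_def
        by (simp only: times_complex.sel Re_complex_of_real Im_complex_of_real) (simp add: mult.commute)
    qed
    ultimately have "(\<lambda>j. b ^ j * C j) sums Re (H (complex_of_real b))"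
      using sums_Re by fastforce
    moreover have "H (complex_of_real b) = complex_of_real (sqrt (squared_speed b / 3))"
    proof -
      have "squared_speed b / 3 \<ge> 0" using squared_speed_near_1[of b] b by linarith
      moreover have "G (complex_of_real b) / 3 = complex_of_real (squared_speed b / 3)"
        using complex_speed_of_real[of b] b by (simp add: G_def)
      ultimately show ?thesis unfolding H_def by (simp only: of_real_sqrt)
    qed
    ultimately show "(\<lambda>j. b ^ j * C j) sums sqrt (squared_speed b / 3)" by simp
  qed
qed

lemma squared_speed_even: "squared_speed (- b) = squared_speed b"
proof -
  have "(- b) ^ j * speed_coeff j = b ^ j * speed_coeff j" for j
    by (cases "even j") (auto simp: speed_coeff_odd)
  then show ?thesis unfolding squared_speed_def by (simp only:)
qed

text \<open>By evenness and \<open>\<mu>\<^sub>2 = 1/2\<close> the series continues with its fourth-order term.\<close>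

lemma squared_speed_expansion:
  assumes "\<bar>b\<bar> \<le> 1/16000"
  shows "\<bar>squared_speed b - (1 + b\<^sup>2 / 2)\<bar> \<le> 20000 ^ 4 * b ^ 4"
proof -
  note S = summable_norm_cancel[OF summable_speed_term[OF assms]]
  have e: "speed_coeff 0 = 1" "speed_coeff 1 = 0" "speed_coeff 3 = 0"
    by (simp_all add: speed_coeff_odd speed_coeff_def[of 0])
  have "squared_speed b - (1 + b\<^sup>2 / 2) = (\<Sum>j. b ^ (j + 4) * speed_coeff (j + 4))"
    using suminf_split_initial_segment[OF S, of 4] e speed_coeff_2
    by (simp add: squared_speed_def numeral_eq_Suc)
  also have "\<bar>\<dots>\<bar> \<le> (\<Sum>j. b ^ 4 * 4000 ^ 4 * (1/4) ^ j)"
    unfolding real_norm_def[symmetric]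
  proof (rule norm_suminf_le)
    fix j
    have "norm (b ^ (j + 4) * speed_coeff (j + 4)) = \<bar>b\<bar> ^ 4 * (\<bar>b\<bar> ^ j * \<bar>speed_coeff (j + 4)\<bar>)"
      by (simp add: abs_mult power_add power_abs mult_ac)
    also have "\<dots> \<le> \<bar>b\<bar> ^ 4 * ((1/16000) ^ j * (6/125 * 4000 ^ (j + 4)))"
      using assms by (intro mult_left_mono mult_mono power_mono speed_coeff_le) auto
    also have "\<dots> = 6/125 * (b ^ 4 * 4000 ^ 4 * ((1/16000) * 4000) ^ j)"
      by (simp only: power_mult_distrib power_add) simp
    also have "\<dots> \<le> b ^ 4 * 4000 ^ 4 * (1/4) ^ j" by simp
    finally show "norm (b ^ (j + 4) * speed_coeff (j + 4)) \<le> b ^ 4 * 4000 ^ 4 * (1/4) ^ j" .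
  qed (auto intro!: summable_mult summable_geometric)
  also have "\<dots> = b ^ 4 * 4000 ^ 4 * (1 / (1 - 1/4))"
    by (subst suminf_mult) (auto intro!: summable_geometric simp: suminf_geometric)
  also have "\<dots> \<le> 20000 ^ 4 * b ^ 4" by simp
  finally show ?thesis .
qed

text \<open>Since \<open>\<bar>s - t\<bar> \<le> \<bar>s\<^sup>2 - t\<^sup>2\<bar>\<close> for \<open>s \<ge> 0\<close>, \<open>t \<ge> 1\<close>, the expansion of \<open>\<mu>\<close> carries over to its square root.\<close>

lemma sqrt_squared_speed_expansion:
  assumes "\<bar>b\<bar> \<le> 1/16000"
  shows "\<bar>sqrt (squared_speed b) - (1 + b\<^sup>2 / 4)\<bar> \<le> (20000 ^ 4 + 1) * b ^ 4"
proof -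
  define s t where "s = sqrt (squared_speed b)" and "t = 1 + b\<^sup>2 / 4"
  have pos: "squared_speed b \<ge> 0" using squared_speed_near_1[OF assms] by linarith
  have st: "s \<ge> 0" "t \<ge> 1" using pos by (simp_all add: s_def t_def)
  \<comment> \<open>\<open>t\<^sup>2\<close> differs from the truncated expansion of \<open>\<mu>\<close> by \<open>b\<^sup>4 / 16\<close>\<close>
  have "\<bar>s - t\<bar> * 1 \<le> \<bar>s - t\<bar> * (s + t)" using st by (intro mult_left_mono) auto
  also have "\<dots> = \<bar>(s - t) * (s + t)\<bar>" using st by (simp add: abs_mult)
  also have "(s - t) * (s + t) = squared_speed b - (1 + b\<^sup>2 / 2) - b ^ 4 / 16"
  proof -
    have "s * s = squared_speed b" using pos by (simp add: s_def)
    moreover have "t * t = 1 + b\<^sup>2 / 2 + b ^ 4 / 16"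
      by (simp add: t_def power2_eq_square eval_nat_numeral field_simps)
    ultimately show ?thesis by (simp add: algebra_simps)
  qed
  also have "\<bar>\<dots>\<bar> \<le> \<bar>squared_speed b - (1 + b\<^sup>2 / 2)\<bar> + b ^ 4 / 16"
    using abs_triangle_ineq4[of "squared_speed b - (1 + b\<^sup>2 / 2)" "b ^ 4 / 16"] by simp
  also have "\<dots> \<le> 20000 ^ 4 * b ^ 4 + b ^ 4" using squared_speed_expansion[OF assms] by simp
  finally show ?thesis by (simp add: s_def t_def distrib_right)
qed


section \<open>Undoing the scaling\<close>

lemma H2_bounded_stokes_poly: "H2_bounded (stokes_poly 0 m) (stokes_norm m)"
proof -
  have "H2_bounded (\<lambda>z. \<Sum>n\<in>{- int m..int m}. stokes m n * cos (of_int n * z)) (stokes_norm m)"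
    unfolding stokes_norm_def by (rule H2_bounded_cos_poly) (auto simp: stokes_reflect)
  then show ?thesis unfolding stokes_poly_0[symmetric] .
qed

lemma stokes_poly_0_0 [simp]: "stokes_poly p 0 z = 0" "stokes_norm 0 = 0"
  by (simp_all add: stokes_poly_def stokes_norm_def)

lemma power_even_exponent:
  fixes k :: real
  assumes "k \<noteq> 0" "m \<noteq> 0"
  shows "k ^ (2 * m - 2) = (k\<^sup>2) ^ m / k\<^sup>2" "k ^ (2 * m - 1) = (k\<^sup>2) ^ m / k"
proof -
  obtain n where m: "m = Suc n" using assms(2) by (cases m) auto
  show "k ^ (2 * m - 2) = (k\<^sup>2) ^ m / k\<^sup>2" "k ^ (2 * m - 1) = (k\<^sup>2) ^ m / k"
    using assms(1) by (simp_all add: m power2_eq_square power_mult power_mult_distrib)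
qed

text \<open>Truncated subtraction turns the exponent into 0 at \<open>m = 0\<close>, where the profile vanishes anyway; thus every
  term is a polynomial in \<open>a\<close> and \<open>k\<close>.\<close>

definition wave_profile :: "real \<Rightarrow> real \<Rightarrow> real \<Rightarrow> real" where
  "wave_profile a k z = (\<Sum>\<^sub>\<infinity>m. a ^ m * k ^ (2 * m - 2) * stokes_poly 0 m z)"

lemma wave_domainD:
  assumes "(a, k) \<in> wave_domain (1/16000)"
  shows "k > 0" "\<bar>k\<^sup>2 * a\<bar> \<le> 1/16000" "\<bar>k\<^sup>2 * a\<bar> < 1/16000"
  using assms by (auto simp: wave_domain_def abs_mult mult.commute)

lemma wave_profile_term: 
  assumes "k > 0"
  shows "a ^ m * k ^ (2 * m - 2) * stokes_poly 0 m z = (k\<^sup>2 * a) ^ m * stokes_poly 0 m z / k\<^sup>2"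
  using assms by (cases "m = 0") (simp_all add: power_even_exponent power_mult_distrib)

lemma wave_profile_majorant_summable:
  assumes "(a, k) \<in> wave_domain (1/16000)"
  shows "(\<lambda>m. \<bar>a\<bar> ^ m * k ^ (2 * m - 2) * stokes_norm m) summable_on UNIV"
proof (rule norm_summable_imp_summable_on, rule summable_comparison_test')
  note k = wave_domainD[OF assms]
  show "summable (\<lambda>m. 1 / k\<^sup>2 * (1/4) ^ m)" by (intro summable_mult summable_geometric) auto
  fix m
  show "norm (norm (\<bar>a\<bar> ^ m * k ^ (2 * m - 2) * stokes_norm m)) \<le> 1 / k\<^sup>2 * (1/4) ^ m"
  proof (cases "m = 0")
    case False
    have "norm (norm (\<bar>a\<bar> ^ m * k ^ (2 * m - 2) * stokes_norm m)) = 1 / k\<^sup>2 * (\<bar>k\<^sup>2 * a\<bar> ^ m * stokes_norm m)"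
      using k(1) False stokes_norm_nonneg[of m]
      by (simp add: power_even_exponent power_mult_distrib abs_mult power_abs)
    also have "\<dots> \<le> 1 / k\<^sup>2 * ((1/16000) ^ m * 4000 ^ m)"
      using k by (intro mult_left_mono mult_mono power_mono stokes_norm_le stokes_norm_nonneg) auto
    also have "(1/16000) ^ m * 4000 ^ m = (1/4::real) ^ m" by (simp flip: power_mult_distrib)
    finally show ?thesis .
  qed simp
qed

lemma wave_profile_has_sum:
  assumes "(a, k) \<in> wave_domain (1/16000)"
  shows "((\<lambda>m. a ^ m * k ^ (2 * m - 2) * stokes_poly 0 m z) has_sum wave_profile a k z) UNIV"
    and "wave_profile a k z = stokes_wave 0 (k\<^sup>2 * a) z / k\<^sup>2"
proof -
  note k = wave_domainD[OF assms]
  have "((\<lambda>m. (k\<^sup>2 * a) ^ m * stokes_poly 0 m z) has_sum stokes_wave 0 (k\<^sup>2 * a) z) UNIV"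
    unfolding stokes_wave_def
    by (rule norm_summable_imp_has_sum[OF summable_stokes_term[OF k(2)]
          summable_sums[OF summable_norm_cancel[OF summable_stokes_term[OF k(2)]]]])
  from has_sum_divide_const[OF this, of "k\<^sup>2"]
  have "((\<lambda>m. a ^ m * k ^ (2 * m - 2) * stokes_poly 0 m z) has_sum stokes_wave 0 (k\<^sup>2 * a) z / k\<^sup>2) UNIV"
    by (simp only: wave_profile_term[OF k(1)])
  then show "((\<lambda>m. a ^ m * k ^ (2 * m - 2) * stokes_poly 0 m z) has_sum wave_profile a k z) UNIV"
    "wave_profile a k z = stokes_wave 0 (k\<^sup>2 * a) z / k\<^sup>2"
    unfolding wave_profile_def by (simp_all add: has_sum_iff)
qed

lemma wave_profile_H2_even:
  assumes "(a, k) \<in> wave_domain (1/16000)"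
  shows "wave_profile a k \<in> H2_even"
proof (rule H2_boundedD(1), rule H2_bounded_infsum[OF _ wave_profile_majorant_summable[OF assms]])
  show "H2_bounded (\<lambda>z. a ^ m * k ^ (2 * m - 2) * stokes_poly 0 m z) (\<bar>a\<bar> ^ m * k ^ (2 * m - 2) * stokes_norm m)" for m
    using H2_bounded_cmult[OF H2_bounded_stokes_poly, of "a ^ m * k ^ (2 * m - 2)" m] wave_domainD(1)[OF assms]
    by (simp add: abs_mult power_abs)
qed (rule wave_profile_has_sum[OF assms])

lemma stokes_poly_low_order:
  "stokes_poly 0 (Suc 0) z = cos z"
  "stokes_poly 0 2 z = - 1/2 + 1/2 * cos (2 * z)"
  "stokes_poly 0 3 z = 7/16 * cos (3 * z)"
  unfolding stokes_poly_0 by (simp_all add: atLeastAtMost_int_rec stokes_1 stokes_2 stokes_3)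

text \<open>The terms of order 0 to 3 are the stated polynomial. For \<open>\<bar>a\<bar> \<le> \<delta>\<close> the tail is at most \<open>(\<bar>a\<bar> / \<delta>)\<^sup>4\<close> times
  the majorant series at \<open>a = \<delta>\<close>.\<close>

lemma wave_profile_remainder:
  assumes k: "k > 0"
  shows "(\<lambda>a. H2_norm (\<lambda>z. wave_profile a k z - (a * cos z
            + a\<^sup>2 * (- (k\<^sup>2 / 2) + k\<^sup>2 / 2 * cos (2 * z)) + a ^ 3 * (7 * k ^ 4 / 16) * cos (3 * z))))
         \<in> O[at 0](\<lambda>a. a ^ 4)"
proof -
  \<comment> \<open>half of the admissible amplitude, to stay inside the open domain\<close>
  define \<delta> where "\<delta> = 1 / (32000 * k\<^sup>2)"
  have \<delta>: "\<delta> > 0" using k by (simp add: \<delta>_def)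
  have dom: "(a, k) \<in> wave_domain (1/16000)" if "\<bar>a\<bar> \<le> \<delta>" for a
  proof -
    have "\<bar>a\<bar> * k\<^sup>2 \<le> \<delta> * k\<^sup>2" using that by (intro mult_right_mono) auto
    then show ?thesis using k by (simp add: wave_domain_def \<delta>_def)
  qed
  define T where "T m = \<delta> ^ m * k ^ (2 * m - 2) * stokes_norm m / \<delta> ^ 4" for m
  have T: "T summable_on {4..}"
    unfolding T_def divide_inverse
    using wave_profile_majorant_summable[OF dom[of \<delta>]] \<delta>
    by (intro summable_on_cmult_left) (auto intro: summable_on_subset)
  have bound: "norm (H2_norm (\<lambda>z. wave_profile a k z - (a * cos z
            + a\<^sup>2 * (- (k\<^sup>2 / 2) + k\<^sup>2 / 2 * cos (2 * z)) + a ^ 3 * (7 * k ^ 4 / 16) * cos (3 * z))))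
        \<le> infsum T {4..} * norm (a ^ 4)" if a: "\<bar>a\<bar> \<le> \<delta>" for a
  proof -
    have bd: "H2_bounded (\<lambda>z. wave_profile a k z - (a * cos z
            + a\<^sup>2 * (- (k\<^sup>2 / 2) + k\<^sup>2 / 2 * cos (2 * z)) + a ^ 3 * (7 * k ^ 4 / 16) * cos (3 * z)))
         (\<Sum>\<^sub>\<infinity>m\<in>{4..}. \<bar>a\<bar> ^ 4 * T m)"
    proof (rule H2_bounded_infsum)
      show "(\<lambda>m. \<bar>a\<bar> ^ 4 * T m) summable_on {4..}" by (intro summable_on_cmult_right T)
      fix m :: nat assume m: "m \<in> {4..}"
      show "H2_bounded (\<lambda>z. a ^ m * k ^ (2 * m - 2) * stokes_poly 0 m z) (\<bar>a\<bar> ^ 4 * T m)"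
      proof (rule H2_bounded_mono[OF H2_bounded_cmult[OF H2_bounded_stokes_poly]])
        have d: "\<delta> ^ m = \<delta> ^ 4 * \<delta> ^ (m - 4)" "\<bar>a\<bar> ^ m = \<bar>a\<bar> ^ 4 * \<bar>a\<bar> ^ (m - 4)"
          using power_add[of \<delta> 4 "m - 4"] power_add[of "\<bar>a\<bar>" 4 "m - 4"] m by simp_all
        have "\<bar>a ^ m * k ^ (2 * m - 2)\<bar> * stokes_norm m = \<bar>a\<bar> ^ 4 * (\<bar>a\<bar> ^ (m - 4) * k ^ (2 * m - 2) * stokes_norm m)"
          using k by (simp add: abs_mult power_abs d)
        also have "\<dots> \<le> \<bar>a\<bar> ^ 4 * (\<delta> ^ (m - 4) * k ^ (2 * m - 2) * stokes_norm m)"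
          using a k \<delta> by (intro mult_left_mono mult_right_mono power_mono stokes_norm_nonneg) auto
        also have "\<dots> = \<bar>a\<bar> ^ 4 * T m" using \<delta> by (simp add: T_def d)
        finally show "\<bar>a ^ m * k ^ (2 * m - 2)\<bar> * stokes_norm m \<le> \<bar>a\<bar> ^ 4 * T m" .
      qed
    next
      fix z
      have "((\<lambda>m. a ^ m * k ^ (2 * m - 2) * stokes_poly 0 m z) has_sum
          (wave_profile a k z - (\<Sum>m<4. a ^ m * k ^ (2 * m - 2) * stokes_poly 0 m z))) (UNIV - {..<4})"
        by (rule has_sum_Diff[OF wave_profile_has_sum(1)[OF dom[OF a]]]) auto
      moreover have "UNIV - {..<4} = {4::nat..}" by auto
      moreover have "(\<Sum>m<4. a ^ m * k ^ (2 * m - 2) * stokes_poly 0 m z) = a * cos z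
            + a\<^sup>2 * (- (k\<^sup>2 / 2) + k\<^sup>2 / 2 * cos (2 * z)) + a ^ 3 * (7 * k ^ 4 / 16) * cos (3 * z)"
      proof -
        have "{..<4} = {0, Suc 0, 2, 3::nat}" by auto
        then show ?thesis by (simp add: stokes_poly_low_order algebra_simps)
      qed
      ultimately show "((\<lambda>m. a ^ m * k ^ (2 * m - 2) * stokes_poly 0 m z) has_sum
          (wave_profile a k z - (a * cos z
            + a\<^sup>2 * (- (k\<^sup>2 / 2) + k\<^sup>2 / 2 * cos (2 * z)) + a ^ 3 * (7 * k ^ 4 / 16) * cos (3 * z)))) {4..}"
        by simp
    qed
    have tail: "(\<Sum>\<^sub>\<infinity>m\<in>{4..}. \<bar>a\<bar> ^ 4 * T m) = infsum T {4..} * norm (a ^ 4)"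
      using T by (subst infsum_cmult_right) (auto simp: power_abs)
    show ?thesis
      using H2_boundedD(2)[OF bd] unfolding tail real_norm_def abs_of_nonneg[OF H2_norm_nonneg] .
  qed
  have "eventually (\<lambda>a. dist a 0 < \<delta>) (at (0::real))"
    unfolding eventually_at using \<delta> by blast
  then have near: "eventually (\<lambda>a. \<bar>a\<bar> \<le> \<delta>) (at (0::real))"
    by (rule eventually_mono) simp
  show ?thesis
    by (rule bigoI, rule eventually_mono[OF near], rule bound)
qed

lemma wave_profile_deriv:
  assumes "(a, k) \<in> wave_domain (1/16000)"
  shows "(deriv ^^ n) (wave_profile a k) = (\<lambda>z. stokes_wave n (k\<^sup>2 * a) z / k\<^sup>2)"
proof (induction n)
  case 0
  show ?case using wave_profile_has_sum(2)[OF assms] by auto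
next
  case (Suc n)
  show ?case unfolding funpow.simps o_def Suc.IH
    by (intro ext DERIV_imp_deriv DERIV_cdivide stokes_wave_deriv wave_domainD(2)[OF assms])
qed

lemma smooth_wave_profile:
  assumes "(a, k) \<in> wave_domain (1/16000)"
  shows "smooth (wave_profile a k)"
  unfolding smooth_def wave_profile_deriv[OF assms] real_differentiable_def
  by (intro allI exI) (rule DERIV_cdivide[OF stokes_wave_deriv[OF wave_domainD(2)[OF assms]]])

text \<open>With \<open>z = k (x - c t)\<close> the mixed derivative contributes \<open>-2 c u\<^sub>t\<^sub>x = 2 c\<^sup>2 k\<^sup>2 \<eta>''\<close>, which raises the coefficient
  \<open>c\<^sup>2\<close> in front of the second derivative to \<open>3 c\<^sup>2\<close>.\<close>

lemma traveling_wave_solution: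
  assumes "\<And>z. (\<eta> has_real_derivative \<eta>' z) (at z)" "\<And>z. (\<eta>' has_real_derivative \<eta>'' z) (at z)"
    and ode: "\<And>z. (3 * c\<^sup>2 - 2 * \<eta> z) * k\<^sup>2 * \<eta>'' z - k\<^sup>2 * (\<eta>' z)\<^sup>2 + \<eta> z = 0"
  shows "shallow_water_solution c (\<lambda>x t. \<eta> (k * (x - c * t)))"
  unfolding shallow_water_solution_def
proof (intro exI allI conjI)
  let ?p = "\<lambda>x t. k * (x - c * t)"
  fix x t
  show "((\<lambda>y. \<eta> (?p y t)) has_real_derivative k * \<eta>' (?p x t)) (at x)"
    by (rule DERIV_cong[OF DERIV_chain2[OF assms(1)]]) (auto intro!: derivative_eq_intros)
  show "((\<lambda>y. k * \<eta>' (?p y t)) has_real_derivative k * (\<eta>'' (?p x t) * k)) (at x)"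
    by (intro DERIV_cmult DERIV_chain2[OF assms(2)]) (auto intro!: derivative_eq_intros)
  show "((\<lambda>s. \<eta> (?p x s)) has_real_derivative - (k * c) * \<eta>' (?p x t)) (at t)"
    by (rule DERIV_cong[OF DERIV_chain2[OF assms(1)]]) (auto intro!: derivative_eq_intros)
  show "((\<lambda>y. - (k * c) * \<eta>' (?p y t)) has_real_derivative - (k * c) * (\<eta>'' (?p x t) * k)) (at x)"
    by (intro DERIV_cmult DERIV_chain2[OF assms(2)]) (auto intro!: derivative_eq_intros)
  show "(c\<^sup>2 - 2 * \<eta> (?p x t)) * (k * (\<eta>'' (?p x t) * k)) - (k * \<eta>' (?p x t))\<^sup>2 + \<eta> (?p x t)
      - 2 * c * (- (k * c) * (\<eta>'' (?p x t) * k)) = 0"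
    using ode[of "?p x t"] by (simp add: power2_eq_square algebra_simps)
qed

theorem lemma2p1:
  shows "\<exists>(\<epsilon> :: real \<Rightarrow> real) (\<eta> :: real \<Rightarrow> real \<Rightarrow> real \<Rightarrow> real) (c :: real \<Rightarrow> real \<Rightarrow> real).
    (\<forall>k>0. \<epsilon> k > 0) \<and>
    open {(a, k). 0 < k \<and> \<bar>a\<bar> < \<epsilon> k} \<and>
    H2_analytic2_on \<eta> {(a, k). 0 < k \<and> \<bar>a\<bar> < \<epsilon> k} \<and>
    real_analytic2_on c {(a, k). 0 < k \<and> \<bar>a\<bar> < \<epsilon> k} \<and>
    (\<forall>k>0.
      (\<forall>a. \<bar>a\<bar> < \<epsilon> k \<longrightarrow>
        c a k > 0 \<and> c (- a) k = c a k \<and>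
        smooth (\<eta> a k) \<and>
        (\<forall>z. \<eta> a k (z + 2 * pi) = \<eta> a k z) \<and>
        (\<forall>z. \<eta> a k (- z) = \<eta> a k z) \<and>
        (\<forall>z. (3 * (c a k)\<^sup>2 - 2 * \<eta> a k z) * k\<^sup>2 * deriv (deriv (\<eta> a k)) z
              - k\<^sup>2 * (deriv (\<eta> a k) z)\<^sup>2 + \<eta> a k z = 0) \<and>
        shallow_water_solution (c a k) (\<lambda>x t. \<eta> a k (k * (x - c a k * t)))) \<and>
      (let A0 = - (k\<^sup>2 / 2); A2 = - A0; A3 = 7 * k ^ 4 / 16;
           c0 = 1 / (sqrt 3 * k); c2 = k ^ 3 / (4 * sqrt 3)
       in (\<lambda>a. H2_norm (\<lambda>z. \<eta> a k z
              - (a * cos z + a\<^sup>2 * (A0 + A2 * cos (2 * z)) + a ^ 3 * A3 * cos (3 * z))))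
            \<in> O[at 0](\<lambda>a. a ^ 4) \<and>
          (\<lambda>a. c a k - (c0 + a\<^sup>2 * c2)) \<in> O[at 0](\<lambda>a. a ^ 4)))"
proof -
  define U where "U = wave_domain (1/16000)"
  define \<epsilon> :: "real \<Rightarrow> real" where "\<epsilon> k = 1 / (16000 * k\<^sup>2)" for k
  have U: "{(a, k). 0 < k \<and> \<bar>a\<bar> < \<epsilon> k} = U"
    by (auto simp: U_def wave_domain_def \<epsilon>_def field_simps)
  obtain C :: "nat \<Rightarrow> real" where C: "\<And>b. \<bar>b\<bar> < 1/16000 \<Longrightarrow> (\<lambda>j. b ^ j * C j) sums sqrt (squared_speed b / 3)"
    using sqrt_speed_power_series by blast
  \<comment> \<open>the term \<open>C 0 / k\<close> is split off, the remaining exponents \<open>2 j - 1\<close> of \<open>k\<close> are natural numbers\<close>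
  define v where "v j = (if j = 0 then 0 else C j)" for j
  define c where "c a k = C 0 / k + (\<Sum>\<^sub>\<infinity>j. a ^ j * k ^ (2 * j - 1) * v j)" for a k
  have C_abs: "summable (\<lambda>j. norm (C j * b ^ j))" if "\<bar>b\<bar> < 1/16000" for b
  proof -
    \<comment> \<open>convergence at a slightly larger point gives absolute convergence at \<open>b\<close>\<close>
    obtain x where x: "\<bar>b\<bar> < x" "x < 1/16000" using dense[OF \<open>\<bar>b\<bar> < 1/16000\<close>] by blast
    have "(\<lambda>j. x ^ j * C j) sums sqrt (squared_speed x / 3)" using x by (intro C) linarith
    then have "summable (\<lambda>j. C j * x ^ j)" by (simp add: sums_iff mult.commute)
    then show ?thesis by (rule powser_insidea) (use x in simp)
  qed
  have v_term: "a ^ j * k ^ (2 * j - 1) * v j = (if j = 0 then 0 else C j * (k\<^sup>2 * a) ^ j / k)" if "k > 0" for a k j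
    using that power_even_exponent(2)[of k j] by (cases "j = 0") (simp_all add: v_def power_mult_distrib)
  have v_abs: "summable (\<lambda>j. norm (a ^ j * k ^ (2 * j - 1) * v j))" if "(a, k) \<in> U" for a k
  proof -
    note k = wave_domainD[OF that[unfolded U_def]]
    have S: "summable (\<lambda>j. norm (C j * (k\<^sup>2 * a) ^ j) / k)" by (intro summable_divide C_abs k)
    have le: "norm (a ^ j * k ^ (2 * j - 1) * v j) \<le> norm (C j * (k\<^sup>2 * a) ^ j) / k" for j
      unfolding v_term[OF k(1)] using k(1) by (simp add: abs_mult)
    show ?thesis
      by (rule summable_comparison_test'[OF S, of 0]) (use le in \<open>simp only: real_norm_def abs_abs\<close>)
  qed
  have c_eq: "c a k = sqrt (squared_speed (k\<^sup>2 * a) / 3) / k" if "(a, k) \<in> U" for a k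
  proof -
    note k = wave_domainD[OF that[unfolded U_def]]
    have "(\<lambda>j. (if j = 0 then C 0 / k else 0) + a ^ j * k ^ (2 * j - 1) * v j) = (\<lambda>j. (k\<^sup>2 * a) ^ j * C j / k)"
      unfolding v_term[OF k(1)] by (auto simp: fun_eq_iff)
    moreover have "(\<lambda>j. (if j = 0 then C 0 / k else 0) + a ^ j * k ^ (2 * j - 1) * v j) sums c a k"
      unfolding c_def
      by (rule sums_add[OF sums_single has_sum_imp_sums[OF has_sum_infsum[OF norm_summable_imp_summable_on[OF v_abs[OF that]]]]])
    ultimately have "(\<lambda>j. (k\<^sup>2 * a) ^ j * C j / k) sums c a k" by simp
    then show ?thesis by (rule sums_unique2[OF _ sums_divide[OF C[OF k(3)], of k]])
  qed
  have c_an: "real_analytic2_on c U"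
  proof -
    have "(\<lambda>j. \<bar>a\<bar> ^ j * k ^ (2 * j - 1) * \<bar>v j\<bar>) summable_on UNIV" if "(a, k) \<in> U" for a k
      using v_abs[OF that] wave_domainD(1)[OF that[unfolded U_def]]
      by (intro norm_summable_imp_summable_on) (simp add: abs_mult power_abs)
    then show ?thesis unfolding c_def[abs_def] U_def
      by (intro real_analytic2_on_add real_analytic2_on_const_divide real_analytic2_on_monomial_series)
  qed
  have \<eta>_an: "H2_analytic2_on wave_profile U"
    unfolding wave_profile_def[abs_def] U_def
    by (rule H2_analytic2_on_monomial_series[OF stokes_norm_nonneg H2_bounded_stokes_poly wave_profile_majorant_summable])
  have pointwise: "c a k > 0 \<and> c (- a) k = c a k \<and>
        smooth (wave_profile a k) \<and>
        (\<forall>z. wave_profile a k (z + 2 * pi) = wave_profile a k z) \<and>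
        (\<forall>z. wave_profile a k (- z) = wave_profile a k z) \<and>
        (\<forall>z. (3 * (c a k)\<^sup>2 - 2 * wave_profile a k z) * k\<^sup>2 * deriv (deriv (wave_profile a k)) z
              - k\<^sup>2 * (deriv (wave_profile a k) z)\<^sup>2 + wave_profile a k z = 0) \<and>
        shallow_water_solution (c a k) (\<lambda>x t. wave_profile a k (k * (x - c a k * t)))"
    if ak: "(a, k) \<in> U" for a k
  proof -
    note d = ak[unfolded U_def]
    note k = wave_domainD[OF d]
    define b where "b = k\<^sup>2 * a"
    have pos: "squared_speed b > 0" using squared_speed_near_1[OF k(2)] unfolding b_def by linarith
    have c_sq: "3 * (c a k)\<^sup>2 = squared_speed b / k\<^sup>2"
      using pos by (simp add: c_eq[OF ak] b_def power_divide)
    have minus: "(- a, k) \<in> U" using ak by (simp add: U_def wave_domain_def)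
    have W: "wave_profile a k = (\<lambda>z. stokes_wave 0 b z / k\<^sup>2)"
      "deriv (wave_profile a k) = (\<lambda>z. stokes_wave 1 b z / k\<^sup>2)"
      "deriv (deriv (wave_profile a k)) = (\<lambda>z. stokes_wave 2 b z / k\<^sup>2)"
      using wave_profile_deriv[OF d, of 0] wave_profile_deriv[OF d, of 1] wave_profile_deriv[OF d, of 2]
      by (simp_all add: b_def numeral_2_eq_2)
    have ode: "(3 * (c a k)\<^sup>2 - 2 * (stokes_wave 0 b z / k\<^sup>2)) * k\<^sup>2 * (stokes_wave 2 b z / k\<^sup>2)
              - k\<^sup>2 * (stokes_wave 1 b z / k\<^sup>2)\<^sup>2 + stokes_wave 0 b z / k\<^sup>2 = 0" for z
    proof -
      have "(squared_speed b / k\<^sup>2 - 2 * (stokes_wave 0 b z / k\<^sup>2)) * k\<^sup>2 * (stokes_wave 2 b z / k\<^sup>2)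
              - k\<^sup>2 * (stokes_wave 1 b z / k\<^sup>2)\<^sup>2 + stokes_wave 0 b z / k\<^sup>2
          = ((squared_speed b - 2 * stokes_wave 0 b z) * stokes_wave 2 b z - (stokes_wave 1 b z)\<^sup>2 + stokes_wave 0 b z) / k\<^sup>2"
        using k(1) by (simp add: field_simps power2_eq_square)
      then show ?thesis unfolding c_sq using stokes_wave_equation[of b z] k(2) by (simp add: b_def)
    qed
    have wave_ode: "(3 * (c a k)\<^sup>2 - 2 * wave_profile a k z) * k\<^sup>2 * deriv (deriv (wave_profile a k)) z
              - k\<^sup>2 * (deriv (wave_profile a k) z)\<^sup>2 + wave_profile a k z = 0" for z
      unfolding W(3) unfolding W(2) unfolding W(1) by (rule ode)
    have "shallow_water_solution (c a k) (\<lambda>x t. stokes_wave 0 b (k * (x - c a k * t)) / k\<^sup>2)"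
      by (rule traveling_wave_solution[OF _ _ ode])
         (use stokes_wave_deriv[of b 0] stokes_wave_deriv[of b 1] k(2) in
           \<open>auto simp: b_def numeral_2_eq_2 intro!: DERIV_cdivide\<close>)
    then have "shallow_water_solution (c a k) (\<lambda>x t. wave_profile a k (k * (x - c a k * t)))"
      unfolding W(1) .
    moreover have "c a k > 0" "c (- a) k = c a k"
      using pos k(1) by (simp_all add: c_eq[OF ak] c_eq[OF minus] b_def squared_speed_even)
    moreover have "\<forall>z. wave_profile a k (z + 2 * pi) = wave_profile a k z" "\<forall>z. wave_profile a k (- z) = wave_profile a k z"
      using wave_profile_H2_even[OF d] unfolding H2_even_def by blast+
    ultimately show ?thesis using wave_ode smooth_wave_profile[OF d] by blast
  qed
  have c_exp: "(\<lambda>a. c a k - (1 / (sqrt 3 * k) + a\<^sup>2 * (k ^ 3 / (4 * sqrt 3)))) \<in> O[at 0](\<lambda>a. a ^ 4)" if k: "k > 0" for k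
  proof (rule bigoI)
    have "norm (c a k - (1 / (sqrt 3 * k) + a\<^sup>2 * (k ^ 3 / (4 * sqrt 3))))
        \<le> ((20000 ^ 4 + 1) * k ^ 8 / (sqrt 3 * k)) * norm (a ^ 4)" if a: "\<bar>a\<bar> < \<epsilon> k" for a
    proof -
      have ak: "(a, k) \<in> U" using a k U by auto
      define b where "b = k\<^sup>2 * a"
      have b: "\<bar>b\<bar> \<le> 1/16000" using wave_domainD(2)[OF ak[unfolded U_def]] by (simp add: b_def)
      have "c a k - (1 / (sqrt 3 * k) + a\<^sup>2 * (k ^ 3 / (4 * sqrt 3))) = (sqrt (squared_speed b) - (1 + b\<^sup>2 / 4)) / (sqrt 3 * k)"
        unfolding c_eq[OF ak] using k by (simp add: b_def real_sqrt_divide field_simps eval_nat_numeral)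
      then have "norm (c a k - (1 / (sqrt 3 * k) + a\<^sup>2 * (k ^ 3 / (4 * sqrt 3)))) = \<bar>sqrt (squared_speed b) - (1 + b\<^sup>2 / 4)\<bar> / (sqrt 3 * k)"
        using k by (simp add: abs_mult)
      also have "\<dots> \<le> (20000 ^ 4 + 1) * b ^ 4 / (sqrt 3 * k)"
        using k by (intro divide_right_mono sqrt_squared_speed_expansion b) auto
      also have "\<dots> = ((20000 ^ 4 + 1) * k ^ 8 / (sqrt 3 * k)) * norm (a ^ 4)"
        by (simp add: b_def power_mult_distrib flip: power_mult)
      finally show ?thesis .
    qed
    then show "eventually (\<lambda>a. norm (c a k - (1 / (sqrt 3 * k) + a\<^sup>2 * (k ^ 3 / (4 * sqrt 3))))
        \<le> ((20000 ^ 4 + 1) * k ^ 8 / (sqrt 3 * k)) * norm (a ^ 4)) (at 0)"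
      unfolding eventually_at using k by (intro exI[of _ "\<epsilon> k"]) (auto simp: \<epsilon>_def)
  qed
  show ?thesis
  proof (rule exI[of _ \<epsilon>], rule exI[of _ wave_profile], rule exI[of _ c], unfold U Let_def minus_minus, intro conjI allI impI)
    show "\<epsilon> k > 0" if "k > 0" for k using that by (simp add: \<epsilon>_def)
    show "open U" unfolding U_def by (rule open_wave_domain)
    show "H2_analytic2_on wave_profile U" by (rule \<eta>_an)
    show "real_analytic2_on c U" by (rule c_an)
  next
    fix k a :: real assume "0 < k" "\<bar>a\<bar> < \<epsilon> k"
    then have "(a, k) \<in> U" using U by auto
    note P = pointwise[OF this]
    show "c a k > 0" "c (- a) k = c a k" "smooth (wave_profile a k)"
      "shallow_water_solution (c a k) (\<lambda>x t. wave_profile a k (k * (x - c a k * t)))"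
      using P by blast+
    fix z
    show "wave_profile a k (z + 2 * pi) = wave_profile a k z" "wave_profile a k (- z) = wave_profile a k z"
      "(3 * (c a k)\<^sup>2 - 2 * wave_profile a k z) * k\<^sup>2 * deriv (deriv (wave_profile a k)) z
              - k\<^sup>2 * (deriv (wave_profile a k) z)\<^sup>2 + wave_profile a k z = 0"
      using P by blast+
  next
    fix k :: real assume "0 < k"
    then show "(\<lambda>a. H2_norm (\<lambda>z. wave_profile a k z - (a * cos z
            + a\<^sup>2 * (- (k\<^sup>2 / 2) + k\<^sup>2 / 2 * cos (2 * z)) + a ^ 3 * (7 * k ^ 4 / 16) * cos (3 * z))))
         \<in> O[at 0](\<lambda>a. a ^ 4)"
      "(\<lambda>a. c a k - (1 / (sqrt 3 * k) + a\<^sup>2 * (k ^ 3 / (4 * sqrt 3)))) \<in> O[at 0](\<lambda>a. a ^ 4)"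
      by (rule wave_profile_remainder, rule c_exp)
  qed
qed

end
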